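(* Let $w\in\mathcal S_n$ and let $\delta=(n-1,n-2,\dots,1)$. Then $$\mathcal G_w(x_1,\dots,x_{n-1})=\sum_{\gamma}(-1)^{\ell(\gamma)-m(\gamma)}\,\frac{x^{\delta}}{x^{\alpha(\gamma)}},$$ the sum over all climbing marked chains $\gamma$ in the Bruhat order on $\mathcal S_n$ that climb from $w$ to $\omega_0$. Here $x^{\beta}=x_1^{\beta_1}\cdots x_{n-1}^{\beta_{n-1}}$ for $\beta=(\beta_1,\dots,\beta_{n-1})$.
   Context: Permutations are written in one-line notation, products are compositions $(uv)(i)=u(v(i))$, $s_i$ is the transposition of $i,i+1$, $t_{a,b}$ (with $a<b$) is the transposition of $a,b$, $\ell(w)$ is the number of inversions of $w$, and $\omega_0=[n,n-1,\dots,1]$. Grothendieck polynomials: $s_i$ acts on $\mathbb Z[x_1,\dots,x_n]$ by exchanging $x_i,x_{i+1}$. Let $\pi_i f=\dfrac{(1-x_{i+1})f-s_i((1-x_{i+1})f)}{x_i-x_{i+1}}$ and $\pi_v=\pi_{i_1}\cdots\pi_{i_r}$ for any reduced word $v=s_{i_1}\cdots s_{i_r}$. Put $\mathcal G_{\omega_0}=x_1^{n-1}x_2^{n-2}\cdots x_{n-1}$ and $\mathcal G_w=\pi_{w^{-1}\omega_0}\mathcal G_{\omega_0}$ for $w\in\mathcal S_n$. Chains: for $1\le k<n$, a cover in the $k$-Bruhat order on $\mathcal S_n$ is $w\xrightarrow{(a,b)}w\,t_{a,b}$ with $a\le k<b$ and $\ell(w\,t_{a,b})=\ell(w)+1$.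 A chain in the $k$-Bruhat order is a (possibly empty) sequence of successive covers $w\xrightarrow{(a_1,b_1)}w_1\xrightarrow{(a_2,b_2)}\cdots\xrightarrow{(a_j,b_j)}w_j$. It is increasing if for all $1\le i<j$ either $a_i<a_{i+1}$, or $a_i=a_{i+1}$ and $b_i>b_{i+1}$. A marked chain in the $k$-Bruhat order is a chain together with a set of marked covers that includes the first cover (if there is one), such that cutting the chain at the permutation before each marked cover decomposes it into increasing segments. A climbing marked chain from $w$ to $\omega_0$ is a concatenation, in this order, of marked chains in the $1$-, $2$-, $\dots$, $(n-1)$-Bruhat orders on $\mathcal S_n$ (some possibly empty), starting at $w$ and ending at $\omega_0$, such that the permutation at the end of the chain in the $k$-Bruhat order has the form $[n,n-1,\dots,n-k+1,\dots]$ for each $k$ (the decomposition into these segments is unique). $\ell(\gamma)$ is the total number of covers of $\gamma$, $m(\gamma)$ the total number of marked covers, and the weight $\alpha(\gamma)=(\alpha_1,\dots,\alpha_{n-1})$ has $\alpha_k$ equal to the number of marked covers in the segment in the $k$-Bruhat order. *)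

theory Defs
  imports
    "HOL-Library.Poly_Mapping"
    "HOL-Combinatorics.Permutations"
begin

section \<open>Permutations\<close>

text \<open>
  An element of the symmetric group on \<open>n\<close> letters is a function \<open>w\<close> with
  \<open>w permutes {1..n}\<close>; the product is \<open>\<circ>\<close> and the transposition of \<open>a\<close> and \<open>b\<close>
  is \<open>transpose a b\<close>.
\<close>

text \<open>Such a \<open>w\<close> is the identity off \<open>{1..n}\<close>, so all inversions counted here lie in \<open>{1..n}\<close>.\<close>

definition ell :: "(nat \<Rightarrow> nat) \<Rightarrow> nat" where
  "ell w = card {(i, j). i < j \<and> w j < w i}"

definition omega0 :: "nat \<Rightarrow> nat \<Rightarrow> nat" where
  "omega0 n = (\<lambda>i. if i \<in> {1..n} then n + 1 - i else i)"

definition reduced_word :: "nat \<Rightarrow> nat list \<Rightarrow> (nat \<Rightarrow> nat) \<Rightarrow> bool" where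
  "reduced_word n is v \<longleftrightarrow>
     set is \<subseteq> {1..<n} \<and> foldr (\<lambda>i u. transpose i (i + 1) \<circ> u) is id = v \<and> length is = ell v"


section \<open>Grothendieck polynomials\<close>

text \<open>
  Integer polynomials in variables indexed by \<open>nat\<close>: finitely supported functions from
  exponent vectors to coefficients, with the convolution product of \<open>Poly_Mapping\<close>.
\<close>

type_synonym mpoly = "(nat \<Rightarrow>\<^sub>0 nat) \<Rightarrow>\<^sub>0 int"

definition X :: "nat \<Rightarrow> mpoly" where
  "X i = Poly_Mapping.single (Poly_Mapping.single i 1) 1"

definition xpow :: "nat \<Rightarrow> (nat \<Rightarrow> nat) \<Rightarrow> mpoly" where
  "xpow n \<beta> = (\<Prod>k = 1..n - 1. X k ^ \<beta> k)"

text \<open>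
  The coefficient of an exponent vector \<open>m\<close> in \<open>swap_vars i f\<close> is that of
  \<open>m \<circ> transpose i (i + 1)\<close> in \<open>f\<close>; the lemmas below confirm that this is the
  ring endomorphism exchanging the variables \<open>i\<close> and \<open>i + 1\<close>.
\<close>

definition swap_vars :: "nat \<Rightarrow> mpoly \<Rightarrow> mpoly" where
  "swap_vars i f = Poly_Mapping.map_key (Poly_Mapping.map_key (transpose i (i + 1))) f"

text \<open>
  The quotient \<open>f / g\<close> in the polynomial ring. It is unique for \<open>g \<noteq> 0\<close>, as polynomials
  form an integral domain, and left unspecified when \<open>g\<close> does not divide \<open>f\<close>.
\<close>

definition exact_div :: "mpoly \<Rightarrow> mpoly \<Rightarrow> mpoly" where
  "exact_div f g = (THE q. q * g = f)"

definition pi_op :: "nat \<Rightarrow> mpoly \<Rightarrow> mpoly" where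
  "pi_op i f =
     exact_div ((1 - X (i + 1)) * f - swap_vars i ((1 - X (i + 1)) * f)) (X i - X (i + 1))"

text \<open>
  The common value of \<open>pi_op i\<^sub>1 (\<dots> (pi_op i\<^sub>r f))\<close> over all reduced words of \<open>v\<close>;
  it is unspecified if these values were to differ.
\<close>

definition pi_perm :: "nat \<Rightarrow> (nat \<Rightarrow> nat) \<Rightarrow> mpoly \<Rightarrow> mpoly" where
  "pi_perm n v f = (THE g. \<exists>is. reduced_word n is v \<and> g = foldr pi_op is f)"

definition grothendieck :: "nat \<Rightarrow> (nat \<Rightarrow> nat) \<Rightarrow> mpoly" where
  "grothendieck n w = pi_perm n (inv w \<circ> omega0 n) (xpow n (\<lambda>k. n - k))"


section \<open>Marked chains in the k-Bruhat order\<close>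

text \<open>
  A chain is given by its starting permutation and the list of labels \<open>(a, b)\<close> of its covers,
  which determine the later permutations. In a marked chain each label carries a flag that
  is \<open>True\<close> iff the cover is marked.
\<close>

type_synonym label = "nat \<times> nat"
type_synonym marked_labels = "(label \<times> bool) list"

definition k_bruhat_cover :: "nat \<Rightarrow> nat \<Rightarrow> (nat \<Rightarrow> nat) \<Rightarrow> label \<Rightarrow> bool" where
  "k_bruhat_cover n k u = (\<lambda>(a, b).
     1 \<le> a \<and> a \<le> k \<and> k < b \<and> b \<le> n \<and> ell (u \<circ> transpose a b) = ell u + 1)"

fun k_bruhat_chain :: "nat \<Rightarrow> nat \<Rightarrow> (nat \<Rightarrow> nat) \<Rightarrow> label list \<Rightarrow> bool" where
  "k_bruhat_chain n k u [] \<longleftrightarrow> True"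
| "k_bruhat_chain n k u ((a, b) # c) \<longleftrightarrow>
     k_bruhat_cover n k u (a, b) \<and> k_bruhat_chain n k (u \<circ> transpose a b) c"

definition chain_end :: "(nat \<Rightarrow> nat) \<Rightarrow> label list \<Rightarrow> (nat \<Rightarrow> nat)" where
  "chain_end u c = foldl (\<lambda>v (a, b). v \<circ> transpose a b) u c"

definition increasing :: "label list \<Rightarrow> bool" where
  "increasing c \<longleftrightarrow> successively (\<lambda>(a, b) (a', b'). a < a' \<or> (a = a' \<and> b > b')) c"

text \<open>Cut a marked chain before each marked cover.\<close>

function cut_at_marks :: "marked_labels \<Rightarrow> marked_labels list" where
  "cut_at_marks [] = []"
| "cut_at_marks (x # c) =
     (x # takeWhile (\<lambda>y. \<not> snd y) c) # cut_at_marks (dropWhile (\<lambda>y. \<not> snd y) c)"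
  by pat_completeness auto
termination
  by (relation "measure length") (auto simp: le_imp_less_Suc length_dropWhile_le)

definition marked_chain :: "nat \<Rightarrow> nat \<Rightarrow> (nat \<Rightarrow> nat) \<Rightarrow> marked_labels \<Rightarrow> bool" where
  "marked_chain n k u c \<longleftrightarrow>
     k_bruhat_chain n k u (map fst c) \<and>
     (c \<noteq> [] \<longrightarrow> snd (hd c)) \<and>
     (\<forall>s \<in> set (cut_at_marks c). increasing (map fst s))"


section \<open>Climbing marked chains\<close>

text \<open>
  A climbing marked chain is the list of its \<open>n - 1\<close> segments; the segment in the
  \<open>k\<close>-Bruhat order is \<open>segment \<gamma> k\<close>, for \<open>k = 1, \<dots>, n - 1\<close>. There are only
  finitely many from a given \<open>w\<close>, as every cover raises \<open>ell\<close> by one.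
\<close>

definition segment :: "marked_labels list \<Rightarrow> nat \<Rightarrow> marked_labels" where
  "segment \<gamma> k = \<gamma> ! (k - 1)"

text \<open>The permutation reached from \<open>w\<close> after the first \<open>k\<close> segments.\<close>

definition perm_after :: "(nat \<Rightarrow> nat) \<Rightarrow> marked_labels list \<Rightarrow> nat \<Rightarrow> (nat \<Rightarrow> nat)" where
  "perm_after w \<gamma> k = chain_end w (map fst (concat (take k \<gamma>)))"

definition climbing_marked_chain :: "nat \<Rightarrow> (nat \<Rightarrow> nat) \<Rightarrow> marked_labels list \<Rightarrow> bool" where
  "climbing_marked_chain n w \<gamma> \<longleftrightarrow>
     length \<gamma> = n - 1 \<and>
     (\<forall>k \<in> {1..<n}. marked_chain n k (perm_after w \<gamma> (k - 1)) (segment \<gamma> k) \<and>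
        (\<forall>i \<in> {1..k}. perm_after w \<gamma> k i = n + 1 - i)) \<and>
     perm_after w \<gamma> (n - 1) = omega0 n"

definition num_covers :: "marked_labels list \<Rightarrow> nat" where
  "num_covers \<gamma> = length (concat \<gamma>)"

definition num_marked :: "marked_labels list \<Rightarrow> nat" where
  "num_marked \<gamma> = length (filter snd (concat \<gamma>))"

definition weight :: "marked_labels list \<Rightarrow> nat \<Rightarrow> nat" where
  "weight \<gamma> k = length (filter snd (segment \<gamma> k))"


section \<open>Exchange of variables is a ring endomorphism\<close>

lemma inj_map_key_transpose:
  "inj (Poly_Mapping.map_key (transpose i j) :: (nat \<Rightarrow>\<^sub>0 nat) \<Rightarrow> (nat \<Rightarrow>\<^sub>0 nat))"
proof (rule inj_on_inverseI)
  fix p :: "nat \<Rightarrow>\<^sub>0 nat"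
  show "Poly_Mapping.map_key (transpose i j) (Poly_Mapping.map_key (transpose i j) p) = p"
    by (simp add: Poly_Mapping.map_key_compose Poly_Mapping.map_key_id id_def)
qed

lemma swap_vars_single:
  "swap_vars i (Poly_Mapping.single m c) =
     Poly_Mapping.single (Poly_Mapping.map_key (transpose i (i + 1)) m) c"
proof -
  have "m = Poly_Mapping.map_key (transpose i (i + 1)) (Poly_Mapping.map_key (transpose i (i + 1)) m)"
    by (simp add: Poly_Mapping.map_key_compose Poly_Mapping.map_key_id id_def)
  then show ?thesis
    unfolding swap_vars_def
    using Poly_Mapping.map_key_single[OF inj_map_key_transpose] by metis
qed

lemma swap_vars_add: "swap_vars i (f + g) = swap_vars i f + swap_vars i g"
  unfolding swap_vars_def by (rule Poly_Mapping.map_key_plus[OF inj_map_key_transpose])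

lemma swap_vars_0: "swap_vars i 0 = 0"
  unfolding swap_vars_def by (rule Poly_Mapping.map_key_zero[OF inj_map_key_transpose])

lemma swap_vars_X: "swap_vars i (X j) = X (transpose i (i + 1) j)"
proof -
  have "Poly_Mapping.map_key (transpose i (i + 1)) (Poly_Mapping.single j (1::nat)) =
      Poly_Mapping.single (transpose i (i + 1) j) 1"
    using Poly_Mapping.map_key_single[of "transpose i (i + 1)" "transpose i (i + 1) j" "1::nat"]
    by simp
  then show ?thesis
    by (simp only: X_def swap_vars_single)
qed

lemma swap_vars_const: "swap_vars i (Poly_Mapping.single 0 c) = Poly_Mapping.single 0 c"
  by (simp add: swap_vars_single)

lemma mpoly_induct:
  fixes f :: mpoly
  assumes "P 0" and "\<And>f m c. P f \<Longrightarrow> P (f + Poly_Mapping.single m c)"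
  shows "P f"
proof (induction f rule: Poly_Mapping.update_induct)
  case const
  show ?case by (fact assms(1))
next
  case (update f a b)
  have "Poly_Mapping.update a b f = f + Poly_Mapping.single a b"
    by (rule poly_mapping_eqI)
       (use update(1) in \<open>auto simp: lookup_add lookup_single lookup_update when_def in_keys_iff\<close>)
  then show ?case using assms(2)[OF update(3)] by simp
qed

lemma swap_vars_mult: "swap_vars i (f * g) = swap_vars i f * swap_vars i g"
proof -
  have single: "swap_vars i (Poly_Mapping.single a c * Poly_Mapping.single b d) =
      swap_vars i (Poly_Mapping.single a c) * swap_vars i (Poly_Mapping.single b d)" for a b c d
    by (simp add: Poly_Mapping.mult_single swap_vars_single Poly_Mapping.map_key_plus)
  have single': "swap_vars i (f * Poly_Mapping.single b d) =
      swap_vars i f * swap_vars i (Poly_Mapping.single b d)" for b d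
    by (induction f rule: mpoly_induct)
       (simp_all add: single swap_vars_0 swap_vars_add distrib_right)
  then show ?thesis
    by (induction g rule: mpoly_induct)
       (simp_all add: single' swap_vars_0 swap_vars_add distrib_left)
qed

end

theory Submission
  imports Defs
begin

text \<open>
  Write \<open>F w\<close> for the sum over climbing marked chains. The proof shows that \<open>F\<close> obeys the
  recursion that defines Grothendieck polynomials, \<open>pi_op i (F w) = F (w \<circ> transpose i (i + 1))\<close> for
  every descent \<open>i\<close> of \<open>w\<close> (\<open>pi_op_sort_at\<close>). As \<open>F (omega0 n)\<close> is the staircase monomial, each
  reduced word of \<open>inv w \<circ> omega0 n\<close> then leads from it to \<open>F w\<close>. So all reduced words give the same
  polynomial, without recourse to braid relations for \<open>pi_op\<close>.

  Besides the weights of the rows that are already at the top, the one property of \<open>F\<close> that enters is a Monk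
  formula. If the first \<open>k - 1\<close> values of \<open>w\<close> are
  \<open>n, n - 1, \<dots>\<close>, then all covers of the \<open>k\<close>-th segment of a chain from \<open>w\<close> exchange position \<open>k\<close>
  with a later one. Hence \<open>F\<close> is an iterated sum over rows \<open>k\<close>, and splitting off the first
  increasing run of a row (one marked cover, followed by unmarked ones) shows, for \<open>w k < n + 1 - k\<close>,
    \<open>(1 - x\<^sub>k) F w = \<Sum> (-1)\<^bsup>length bs\<^esup> F (end of bs)\<close>,
  the sum over the increasing runs \<open>bs\<close> from \<open>w\<close>, the empty one included (\<open>row_sum_monk\<close>). The right-hand side is
  \<open>((1 - \<tau>\<^sub>k\<^sub>,\<^sub>n) \<dots> (1 - \<tau>\<^sub>k\<^sub>,\<^sub>k\<^sub>+\<^sub>1) F) w\<close>, where \<open>(\<tau>\<^sub>a\<^sub>,\<^sub>b f) w\<close> is \<open>f (w \<circ> transpose a b)\<close> if that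
  permutation covers \<open>w\<close>, and \<open>0\<close> otherwise. Call this product \<open>R\<^sub>k\<close> (\<open>monk_row n k\<close>).

  Since \<open>x\<^sub>k\<close> is not a zero divisor and the other terms of \<open>R\<^sub>k\<close> have larger value in position \<open>k\<close>, a
  function \<open>f\<close> with \<open>(1 - x\<^sub>k) f = R\<^sub>k f\<close> is determined by its values at the top
  (\<open>eq_if_same_monk\<close>). This is applied to \<open>f\<^sub>1 w = pi_op i (F w)\<close> and to \<open>f\<^sub>2 = sort_at i F\<close>, which
  evaluates \<open>F\<close> after removing a descent at \<open>i\<close>.

  For \<open>k < i\<close> both satisfy the Monk formula of row \<open>k\<close>: the factor \<open>1 - x\<^sub>k\<close> commutes with
  \<open>pi_op i\<close>, and \<open>R\<^sub>k\<close> commutes with \<open>sort_at i\<close> (\<open>monk_row_sort_at\<close>).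

  For \<open>k = i\<close> one uses \<open>(1 - x\<^sub>i) \<circ> pi_op i = (pi_op i - 1) \<circ> (1 - x\<^sub>i\<^sub>+\<^sub>1)\<close>. This requires the
  action of \<open>1 - x\<^sub>i\<^sub>+\<^sub>1\<close> on \<open>F w\<close> for a permutation \<open>w\<close> whose position \<open>i\<close> is not yet at the top. It is
  again given by \<open>R\<^sub>i\<^sub>+\<^sub>1\<close>, provided that \<open>w\<close> has a descent at \<open>i\<close> (\<open>monk_second_row\<close>); this rests on the
  Yang-Baxter relation for the operators \<open>1 - \<tau>\<^sub>a\<^sub>,\<^sub>b\<close>. The paths of row \<open>i\<close> from the
  sorted permutation are then matched with the paths of row \<open>i + 1\<close> from \<open>w\<close> (\<open>row_diff_transfer\<close>).
\<close>

section \<open>Demazure operators on polynomials\<close>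

lemma swap_vars_1 [simp]: "swap_vars i 1 = 1"
  using swap_vars_const[of i 1] by (simp add: one_poly_mapping_def single.abs_eq)

lemma swap_vars_uminus: "swap_vars i (- f) = - swap_vars i f"
  using swap_vars_add[of i f "- f"] by (simp add: swap_vars_0 eq_neg_iff_add_eq_0 add.commute)

lemma swap_vars_diff: "swap_vars i (f - g) = swap_vars i f - swap_vars i g"
  using swap_vars_add[of i f "- g"] by (simp add: swap_vars_uminus)

lemma swap_vars_power: "swap_vars i (f ^ m) = swap_vars i f ^ m"
  by (induction m) (simp_all add: swap_vars_mult)

lemma swap_vars_sum: "swap_vars i (sum f A) = (\<Sum>a\<in>A. swap_vars i (f a))"
  by (induction A rule: infinite_finite_induct) (simp_all add: swap_vars_0 swap_vars_add)

lemma swap_vars_prod: "swap_vars i (prod f A) = (\<Prod>a\<in>A. swap_vars i (f a))"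
  by (induction A rule: infinite_finite_induct) (simp_all add: swap_vars_mult)

lemma swap_vars_swap_vars [simp]: "swap_vars i (swap_vars i f) = f"
  by (induction f rule: mpoly_induct)
     (simp_all add: swap_vars_0 swap_vars_add swap_vars_single
        Poly_Mapping.map_key_compose Poly_Mapping.map_key_id id_def)

lemma X_neq_0: "X i \<noteq> 0"
  unfolding X_def by (metis lookup_single_eq lookup_zero one_neq_zero)

lemma X_neq_X: "i \<noteq> j \<Longrightarrow> X i \<noteq> X j"
proof
  assume "i \<noteq> j" "X i = X j"
  then have "Poly_Mapping.single i (1::nat) = Poly_Mapping.single j 1"
    unfolding X_def by (metis lookup_single_eq lookup_single_not_eq one_neq_zero)
  then show False
    using \<open>i \<noteq> j\<close> by (metis lookup_single_eq lookup_single_not_eq one_neq_zero)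
qed

lemma single_power_eq_X_power: "Poly_Mapping.single (Poly_Mapping.single j b) 1 = X j ^ b"
proof (induction b)
  case 0
  then show ?case by simp
next
  case (Suc b)
  have "Poly_Mapping.single j (Suc b) = Poly_Mapping.single j 1 + Poly_Mapping.single j b"
    by (simp flip: single_add)
  then show ?case
    unfolding power_Suc Suc.IH[symmetric] by (simp only: X_def mult_single mult_1)
qed

text \<open>
  The polynomials with this property contain the constants and the variables and are closed under
  sums and products, by \<open>f g - s f \<cdot> s g = (f - s f) g + s f (g - s g)\<close>. Hence the quotient in
  \<open>pi_op\<close> exists, and \<open>pi_op\<close> may be computed with after multiplication by \<open>X i - X (i + 1)\<close>.
\<close>

lemma X_diff_dvd_diff_swap_vars: "X i - X (i + 1) dvd f - swap_vars i f"
proof -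
  define D where "D f \<longleftrightarrow> X i - X (i + 1) dvd f - swap_vars i f" for f
  have D_add: "D (f + g)" if "D f" "D g" for f g
    using dvd_add[OF that[unfolded D_def]] by (simp add: D_def swap_vars_add algebra_simps)
  have D_mult: "D (f * g)" if "D f" "D g" for f g
  proof -
    have "f * g - swap_vars i (f * g) =
        (f - swap_vars i f) * g + swap_vars i f * (g - swap_vars i g)"
      by (simp add: swap_vars_mult algebra_simps)
    then show ?thesis
      using that by (simp add: D_def)
  qed
  have D_const: "D (Poly_Mapping.single 0 c)" for c
    by (simp add: D_def swap_vars_const)
  have D_X: "D (X j)" for j
  proof -
    consider "j = i" | "j = i + 1" | "j \<noteq> i" "j \<noteq> i + 1" by blast
    then show ?thesis
    proof cases
      case 2
      have "X (i + 1) - X i = - (X i - X (i + 1))" by simp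
      then show ?thesis
        unfolding D_def 2 swap_vars_X by (metis dvd_minus_iff dvd_refl transpose_apply_second)
    qed (simp_all add: D_def swap_vars_X)
  qed
  have D_power: "D (X j ^ b)" for j b
    by (induction b) (use D_const[of 1] in \<open>simp_all add: D_mult D_X\<close>)
  have D_single: "D (Poly_Mapping.single m c)" for m :: "nat \<Rightarrow>\<^sub>0 nat" and c
  proof (induction m rule: Poly_Mapping.update_induct)
    case const
    show ?case by (rule D_const)
  next
    case (update f a b)
    have "Poly_Mapping.update a b f = f + Poly_Mapping.single a b"
      by (rule poly_mapping_eqI)
         (use update(1) in \<open>auto simp: lookup_add lookup_single lookup_update when_def in_keys_iff\<close>)
    then have "Poly_Mapping.single (Poly_Mapping.update a b f) c = Poly_Mapping.single f c * X a ^ b"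
      by (simp add: mult_single flip: single_power_eq_X_power)
    then show ?case
      using update D_mult D_power by simp
  qed
  have "D f"
    by (induction f rule: mpoly_induct) (use D_const[of 0] in \<open>simp_all add: D_add D_single\<close>)
  then show ?thesis by (simp add: D_def)
qed

lemma exact_div_eqI:
  assumes "q * g = f" "g \<noteq> 0"
  shows "exact_div f g = q"
  unfolding exact_div_def
proof (rule the_equality)
  show "q' = q" if "q' * g = f" for q'
    using that assms by (metis mult_right_cancel)
qed (fact assms(1))

lemma X_diff_neq_0: "X i - X (i + 1) \<noteq> 0"
  using X_neq_X[of i "i + 1"] by simp

lemma pi_op_eqI:
  assumes "q * (X i - X (i + 1)) = (1 - X (i + 1)) * f - (1 - X i) * swap_vars i f"
  shows "pi_op i f = q"
  unfolding pi_op_def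
  by (rule exact_div_eqI) (use assms X_diff_neq_0 in \<open>simp_all add: swap_vars_mult swap_vars_diff swap_vars_X\<close>)

lemma pi_op_mult_X_diff:
  "pi_op i f * (X i - X (i + 1)) = (1 - X (i + 1)) * f - (1 - X i) * swap_vars i f"
proof -
  obtain q where "(1 - X (i + 1)) * f - swap_vars i ((1 - X (i + 1)) * f) = (X i - X (i + 1)) * q"
    using X_diff_dvd_diff_swap_vars by (rule dvdE)
  then have "q * (X i - X (i + 1)) = (1 - X (i + 1)) * f - (1 - X i) * swap_vars i f"
    by (simp add: swap_vars_mult swap_vars_diff swap_vars_X mult.commute)
  then show ?thesis
    using pi_op_eqI by blast
qed

lemma pi_op_diff: "pi_op i (f - g) = pi_op i f - pi_op i g"
  by (rule pi_op_eqI)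
     (simp only: left_diff_distrib[of "pi_op i f"] pi_op_mult_X_diff swap_vars_diff,
      simp add: algebra_simps)

lemma pi_op_symmetric_mult:
  assumes "swap_vars i g = g"
  shows "pi_op i (g * f) = g * pi_op i f"
  by (rule pi_op_eqI)
     (simp only: mult.assoc pi_op_mult_X_diff swap_vars_mult assms, simp add: algebra_simps)

lemma pi_op_symmetric:
  assumes "swap_vars i f = f"
  shows "pi_op i f = f"
  by (rule pi_op_eqI) (simp add: assms algebra_simps)

lemma swap_vars_pi_op: "swap_vars i (pi_op i f) = pi_op i f"
proof -
  have "swap_vars i (pi_op i f * (X i - X (i + 1))) =
      (1 - X i) * swap_vars i f - (1 - X (i + 1)) * f"
    unfolding pi_op_mult_X_diff by (simp add: swap_vars_mult swap_vars_diff swap_vars_X)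
  moreover have "swap_vars i (pi_op i f * (X i - X (i + 1))) =
      swap_vars i (pi_op i f) * - (X i - X (i + 1))"
    unfolding swap_vars_mult by (simp add: swap_vars_diff swap_vars_X)
  ultimately have "swap_vars i (pi_op i f) * - (X i - X (i + 1)) =
      - ((1 - X (i + 1)) * f - (1 - X i) * swap_vars i f)"
    by simp
  then have "swap_vars i (pi_op i f) * (X i - X (i + 1)) =
      (1 - X (i + 1)) * f - (1 - X i) * swap_vars i f"
    by (simp only: mult_minus_right neg_equal_iff_equal)
  then show ?thesis
    using pi_op_eqI by metis
qed

lemma pi_op_idem: "pi_op i (pi_op i f) = pi_op i f"
  by (simp add: pi_op_symmetric swap_vars_pi_op)

lemma pi_op_X_mult_symmetric:
  assumes "swap_vars i f = f"
  shows "pi_op i (X i * f) = f"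
  by (rule pi_op_eqI) (simp add: swap_vars_mult swap_vars_X assms algebra_simps)

text \<open>
  The one relation between \<open>pi_op i\<close> and multiplication that is not plain symmetry. It trades
  \<open>1 - X i\<close> for \<open>1 - X (i + 1)\<close> and so links the Monk formulas of two adjacent rows.
\<close>

lemma one_minus_X_mult_pi_op:
  "(1 - X i) * pi_op i f = pi_op i ((1 - X (i + 1)) * f) - (1 - X (i + 1)) * f"
proof -
  let ?A = "1 - X i" and ?B = "1 - X (i + 1)"
  have "(?A * pi_op i f + ?B * f) * (X i - X (i + 1)) =
      ?A * (?B * f - ?A * swap_vars i f) + ?B * f * (X i - X (i + 1))"
    unfolding pi_op_mult_X_diff[symmetric] by (simp add: algebra_simps)
  also have "\<dots> = ?B * (?B * f) - ?A * swap_vars i (?B * f)"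
    by (simp add: swap_vars_mult swap_vars_diff swap_vars_X algebra_simps)
  finally have "pi_op i (?B * f) = ?A * pi_op i f + ?B * f"
    by (rule pi_op_eqI)
  then show ?thesis by simp
qed

section \<open>The operators attached to covers\<close>

text \<open>
  Bruhat covers, described by values instead of lengths. The condition \<open>inj w\<close> makes every operator
  below act trivially at maps that are not injective, so that the relations between operators hold as
  equations of functions, with no side condition on the argument.
\<close>

definition covers :: "(nat \<Rightarrow> nat) \<Rightarrow> nat \<Rightarrow> nat \<Rightarrow> bool" where
  "covers w a b \<longleftrightarrow>
     inj w \<and> w a < w b \<and> (\<forall>c \<in> {a<..<b}. \<not> (w a < w c \<and> w c < w b))"

text \<open>
  The operator \<open>1 - \<tau>\<^sub>a\<^sub>,\<^sub>b\<close> on functions of permutations. Operators on functions compose in the order in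
  which the covers are taken: \<open>cover_diff a b (cover_diff c d f)\<close> first steps along \<open>(a, b)\<close>.
\<close>

definition cover_diff ::
    "nat \<Rightarrow> nat \<Rightarrow> ((nat \<Rightarrow> nat) \<Rightarrow> 'r) \<Rightarrow> (nat \<Rightarrow> nat) \<Rightarrow> 'r::ab_group_add" where
  "cover_diff a b f w = (if covers w a b then f w - f (w \<circ> transpose a b) else f w)"

text \<open>
  The action of the 0-Hecke algebra dual to right multiplication; \<open>pi_op i\<close> realises it on polynomials.
\<close>

definition sort_at :: "nat \<Rightarrow> ((nat \<Rightarrow> nat) \<Rightarrow> 'r) \<Rightarrow> (nat \<Rightarrow> nat) \<Rightarrow> 'r" where
  "sort_at i f w = (if inj w \<and> w (i + 1) < w i then f (w \<circ> transpose i (i + 1)) else f w)"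

definition row_diff :: "nat \<Rightarrow> nat list \<Rightarrow> ((nat \<Rightarrow> nat) \<Rightarrow> 'r) \<Rightarrow> (nat \<Rightarrow> nat) \<Rightarrow> 'r::ab_group_add" where
  "row_diff k bs f = foldr (cover_diff k) bs f"

lemma inj_comp_transpose [simp]: "inj (w \<circ> transpose a b) \<longleftrightarrow> inj w"
proof
  assume "inj (w \<circ> transpose a b)"
  then have "inj ((w \<circ> transpose a b) \<circ> transpose a b)"
    by (rule inj_compose) simp
  then show "inj w"
    by (simp add: comp_assoc)
qed (simp add: inj_compose)

lemma not_inj_cover_diff: "\<not> inj w \<Longrightarrow> cover_diff a b f w = f w"
  by (simp add: cover_diff_def covers_def)

lemma not_inj_sort_at: "\<not> inj w \<Longrightarrow> sort_at i f w = f w"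
  by (simp add: sort_at_def)

lemma covers_transpose_adjacent:
  assumes "a < i" "b < i \<or> i + 1 < b"
  shows "covers (w \<circ> transpose i (i + 1)) a b \<longleftrightarrow> covers w a b"
proof -
  let ?s = "transpose i (i + 1)"
  have img: "?s ` {a<..<b} = {a<..<b}"
    using assms by (intro transpose_image_eq) auto
  have "(\<forall>c \<in> ?s ` {a<..<b}. P c) \<longleftrightarrow> (\<forall>c \<in> {a<..<b}. P (?s c))" for P
    by blast
  note between = this[of "\<lambda>c. \<not> (w a < w c \<and> w c < w b)", unfolded img, symmetric]
  have ends: "?s a = a" "?s b = b"
    using assms by auto
  show ?thesis
    unfolding covers_def comp_apply ends between inj_comp_transpose ..
qed

lemma cover_diff_sort_at:
  assumes "a < i" "b < i \<or> i + 1 < b"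
  shows "cover_diff a b (sort_at i f) = sort_at i (cover_diff a b f)"
proof
  fix w :: "nat \<Rightarrow> nat"
  have "(w \<circ> transpose a b) i = w i" "(w \<circ> transpose a b) (i + 1) = w (i + 1)"
    using assms by auto
  moreover have "w \<circ> transpose a b \<circ> transpose i (i + 1) = w \<circ> transpose i (i + 1) \<circ> transpose a b"
    using assms by (auto simp: fun_eq_iff transpose_def)
  ultimately show "cover_diff a b (sort_at i f) w = sort_at i (cover_diff a b f) w"
    using covers_transpose_adjacent[OF assms, of w]
    by (simp add: cover_diff_def sort_at_def del: comp_apply)
qed

text \<open>
  If the order of two disjoint transpositions could not be exchanged, one of the values moved by the
  first step would lie between the two values exchanged by the second one. Comparing the four
  positions and the four values involved rules this out.
\<close>

lemma covers_commute_imp: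
  assumes "a < b" "c < d" "{a, b} \<inter> {c, d} = {}"
    and 1: "covers w a b" and 2: "covers (w \<circ> transpose a b) c d"
  shows "covers w c d \<and> covers (w \<circ> transpose c d) a b"
proof -
  have inj: "inj w" using 1 by (simp add: covers_def)
  have ne: "a \<noteq> c" "a \<noteq> d" "b \<noteq> c" "b \<noteq> d" using assms by auto
  have ab: "w a < w b" and cd: "w c < w d"
    using 1 2 ne by (auto simp: covers_def)
  have A: "\<not> (w a < w e \<and> w e < w b)" if "a < e" "e < b" for e
    using 1 that by (auto simp: covers_def)
  have B: "\<not> (w c < (w \<circ> transpose a b) e \<and> (w \<circ> transpose a b) e < w d)" if "c < e" "e < d" for e
    using 2 that ne by (auto simp: covers_def)
  have Ba: "c < a \<Longrightarrow> a < d \<Longrightarrow> \<not> (w c < w b \<and> w b < w d)"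
    using B[of a] by simp
  have Bb: "c < b \<Longrightarrow> b < d \<Longrightarrow> \<not> (w c < w a \<and> w a < w d)"
    using B[of b] by simp
  have Be: "\<not> (w c < w e \<and> w e < w d)" if "c < e" "e < d" "e \<noteq> a" "e \<noteq> b" for e
    using B[of e] that by simp
  have inj4: "w a \<noteq> w c" "w a \<noteq> w d" "w b \<noteq> w c" "w b \<noteq> w d"
    using inj ne by (simp_all add: inj_eq)
  have Aa: "a < c \<Longrightarrow> c < b \<Longrightarrow> \<not> (w a < w c \<and> w c < w b)"
    and Ad: "a < d \<Longrightarrow> d < b \<Longrightarrow> \<not> (w a < w d \<and> w d < w b)"
    using A by blast+
  have "\<not> (w c < w e \<and> w e < w d)" if "c < e" "e < d" for e
  proof -
    consider "e = a" | "e = b" | "e \<noteq> a" "e \<noteq> b" by blast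
    then show ?thesis
    proof cases
      case 1
      have False if h: "w c < w a" "w a < w d"
      proof -
        have "d < b"
          using Bb h \<open>c < e\<close> 1 assms(1) ne by linarith
        then have "w b < w d"
          using Ad h \<open>e < d\<close> 1 inj4 by linarith
        then show False
          using Ba h \<open>c < e\<close> \<open>e < d\<close> 1 ab by linarith
      qed
      then show ?thesis using 1 by blast
    next
      case 2
      have False if h: "w c < w b" "w b < w d"
      proof -
        have "w a < w c"
          using Bb h \<open>c < e\<close> \<open>e < d\<close> 2 ab inj4 by linarith
        then have "c < a"
          using Aa h \<open>c < e\<close> 2 ne by linarith
        then show False
          using Ba h \<open>e < d\<close> 2 assms(1) by linarith
      qed
      then show ?thesis using 2 by blast
    next
      case 3
      then show ?thesis using Be that by blast
    qed
  qed
  moreover have "\<not> (w a < (w \<circ> transpose c d) e \<and> (w \<circ> transpose c d) e < w b)" if "a < e" "e < b" for e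
  proof -
    consider "e = c" | "e = d" | "e \<noteq> c" "e \<noteq> d" by blast
    then show ?thesis
    proof cases
      case 1
      have False if h: "w a < w d" "w d < w b"
      proof -
        have "b < d"
          using Ad h \<open>a < e\<close> 1 assms(2) ne by linarith
        then have "\<not> (w c < w a)"
          using Bb h \<open>e < b\<close> 1 by linarith
        then show False
          using Aa h \<open>a < e\<close> \<open>e < b\<close> 1 cd inj4 by linarith
      qed
      then show ?thesis using 1 by auto
    next
      case 2
      have False if h: "w a < w c" "w c < w b"
      proof -
        have "c < a"
          using Aa h \<open>e < b\<close> 2 assms(2) ne by linarith
        then have "w d < w b"
          using Ba h \<open>a < e\<close> 2 inj4 by linarith
        then show False
          using Ad h \<open>a < e\<close> \<open>e < b\<close> 2 cd by linarith
      qed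
      then show ?thesis using 2 by auto
    next
      case 3
      then show ?thesis using A that by simp
    qed
  qed
  ultimately show ?thesis
    using inj ab cd ne by (auto simp: covers_def)
qed

lemma cover_diff_commute:
  assumes "a < b" "c < d" "{a, b} \<inter> {c, d} = {}"
  shows "cover_diff a b (cover_diff c d f) = cover_diff c d (cover_diff a b f)"
proof
  fix w :: "nat \<Rightarrow> nat"
  have "covers w a b \<and> covers (w \<circ> transpose a b) c d \<longleftrightarrow> covers w c d \<and> covers (w \<circ> transpose c d) a b"
    using covers_commute_imp[OF assms, of w] covers_commute_imp[of c d a b w] assms by auto
  moreover have "w \<circ> transpose a b \<circ> transpose c d = w \<circ> transpose c d \<circ> transpose a b"
    using assms by (auto simp: fun_eq_iff transpose_def)
  ultimately show "cover_diff a b (cover_diff c d f) w = cover_diff c d (cover_diff a b f) w"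
    by (cases "covers w a b"; cases "covers w c d") (simp_all add: cover_diff_def algebra_simps)
qed

definition no_value_between :: "(nat \<Rightarrow> nat) \<Rightarrow> nat \<Rightarrow> nat \<Rightarrow> nat \<Rightarrow> nat \<Rightarrow> bool" where
  "no_value_between w a b x y \<longleftrightarrow> (\<forall>c \<in> {a<..<b}. \<not> (x < w c \<and> w c < y))"

text \<open>
  For fixed \<open>w\<close> away from three positions, the operators on these positions only see the relative order
  of the three entries and whether some other entry lies between two of them. The relations below
  are checked by running through the six orders.
\<close>

lemma cover_diff_three_positions:
    assumes "a < b" "b < c" and inj: "inj (w(a := p, b := q, c := r))"
  shows "cover_diff a b f (w(a := p, b := q, c := r)) = f (w(a := p, b := q, c := r)) -
           (if p < q \<and> no_value_between w a b p q then f (w(a := q, b := p, c := r)) else 0)" (is ?ab)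
    and "cover_diff b c f (w(a := p, b := q, c := r)) = f (w(a := p, b := q, c := r)) -
           (if q < r \<and> no_value_between w b c q r then f (w(a := p, b := r, c := q)) else 0)" (is ?bc)
    and "cover_diff a c f (w(a := p, b := q, c := r)) = f (w(a := p, b := q, c := r)) -
           (if p < r \<and> no_value_between w a b p r \<and> no_value_between w b c p r \<and> \<not> (p < q \<and> q < r)
            then f (w(a := r, b := q, c := p)) else 0)" (is ?ac)
proof -
  let ?w = "w(a := p, b := q, c := r)"
  have 1: "?w \<circ> transpose a b = w(a := q, b := p, c := r)"
      "?w \<circ> transpose b c = w(a := p, b := r, c := q)"
      "?w \<circ> transpose a c = w(a := r, b := q, c := p)"
    using assms by (auto simp: fun_eq_iff transpose_def)
  have split: "{a<..<c} = {a<..<b} \<union> {b} \<union> {b<..<c}"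
    using assms by auto
  have ab: "covers ?w a b \<longleftrightarrow> p < q \<and> no_value_between w a b p q"
    and bc: "covers ?w b c \<longleftrightarrow> q < r \<and> no_value_between w b c q r"
    using assms by (auto simp: covers_def no_value_between_def)
  have "?w d = w d" if "d \<in> {a<..<b} \<union> {b<..<c}" for d
    using that assms(1,2) by auto
  then have ac: "covers ?w a c \<longleftrightarrow>
      p < r \<and> no_value_between w a b p r \<and> no_value_between w b c p r \<and> \<not> (p < q \<and> q < r)"
    unfolding covers_def no_value_between_def split using assms by (simp add: ball_Un conj_ac)
  show ?ab ?bc ?ac
    unfolding cover_diff_def 1 ab bc ac by (simp, simp, force)
qed

lemma inj_three_positions:
  fixes w :: "nat \<Rightarrow> nat"
  assumes "a < b" "b < c" and "inj (w(a := p, b := q, c := r))"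
  shows "inj (w(a := q, b := p, c := r))" "inj (w(a := p, b := r, c := q))"
proof -
  let ?w = "w(a := p, b := q, c := r)"
  have 1: "?w \<circ> transpose a b = w(a := q, b := p, c := r)"
      "?w \<circ> transpose b c = w(a := p, b := r, c := q)"
    using assms(1,2) by (auto simp: fun_eq_iff transpose_def)
  show "inj (w(a := q, b := p, c := r))" "inj (w(a := p, b := r, c := q))"
    using assms(3) by (simp_all only: 1[symmetric] inj_comp_transpose)
qed

lemma no_value_between_split:
  assumes "x < y" "y < z" "y \<notin> w ` {a<..<b}"
  shows "no_value_between w a b x z \<longleftrightarrow> no_value_between w a b x y \<and> no_value_between w a b y z"
proof -
  have "x < w c \<and> w c < z \<longleftrightarrow> (x < w c \<and> w c < y) \<or> (y < w c \<and> w c < z)" if "c \<in> {a<..<b}" for c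
    using assms that by (cases "w c" y rule: linorder_cases) auto
  then show ?thesis
    unfolding no_value_between_def by (metis (no_types, lifting))
qed

lemma three_positions_not_in_image:
  fixes w :: "nat \<Rightarrow> nat"
  assumes "a < b" "b < c" and "inj (w(a := p, b := q, c := r))"
  shows "{p, q, r} \<inter> w ` {a<..<b} = {}" "{p, q, r} \<inter> w ` {b<..<c} = {}"
proof -
  let ?w = "w(a := p, b := q, c := r)"
  have "w d \<notin> {p, q, r}" if d: "d \<in> {a<..<b} \<union> {b<..<c}" for d
  proof -
    have ne: "d \<noteq> a" "d \<noteq> b" "d \<noteq> c" "a \<noteq> b" "a \<noteq> c" "b \<noteq> c"
      using d assms(1,2) by auto
    then have "?w d \<noteq> ?w a" "?w d \<noteq> ?w b" "?w d \<noteq> ?w c"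
      by (simp_all only: inj_eq[OF assms(3)] not_False_eq_True)
    then show ?thesis
      using ne by simp
  qed
  then show "{p, q, r} \<inter> w ` {a<..<b} = {}" "{p, q, r} \<inter> w ` {b<..<c} = {}"
    by blast+
qed

text \<open>
  Neither factor commutes with sorting the positions \<open>i\<close> and \<open>i + 1\<close>, but the product of the two does:
  the terms in which they differ cancel in pairs.
\<close>

lemma cover_diff_sort_at_adjacent:
  assumes "a < i"
  shows "cover_diff a (Suc i) (cover_diff a i (sort_at i f)) =
         sort_at i (cover_diff a (Suc i) (cover_diff a i f))"
proof
  fix w :: "nat \<Rightarrow> nat"
  define p q r where "p = w a" "q = w i" "r = w (Suc i)"
  define W where "W p q r = w(a := p, i := q, Suc i := r)" for p q r
  have w: "w = W p q r"
    by (simp add: W_def p_q_r_def)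
  show "cover_diff a (Suc i) (cover_diff a i (sort_at i f)) w =
         sort_at i (cover_diff a (Suc i) (cover_diff a i f)) w"
  proof (cases "inj w")
    case False
    then show ?thesis
      by (simp add: not_inj_cover_diff not_inj_sort_at)
  next
    case True
    have inj: "inj (W p q r)" using True w by simp
    have lt: "a < i" "i < Suc i" using assms by auto
    note swaps = inj_three_positions[OF lt, of w, folded W_def]
    have injs: "inj (W p r q)" "inj (W q p r)" "inj (W q r p)" "inj (W r p q)" "inj (W r q p)"
      using inj swaps by blast+
    have trivial: "no_value_between w i (Suc i) x y" for x y
      by (auto simp: no_value_between_def)
    have cd: "cover_diff a i g (W x y z) = g (W x y z) -
           (if x < y \<and> no_value_between w a i x y then g (W y x z) else 0)"
         "cover_diff a (Suc i) g (W x y z) = g (W x y z) -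
           (if x < z \<and> no_value_between w a i x z \<and> \<not> (x < y \<and> y < z) then g (W z y x) else 0)"
         if "inj (W x y z)" for x y z and g :: "(nat \<Rightarrow> nat) \<Rightarrow> 'a"
      using cover_diff_three_positions[OF lt, of w, folded W_def, OF that, of g] by (auto simp: trivial)
    have Wi: "W x y z i = y" "W x y z (Suc i) = z" for x y z
      using assms by (auto simp: W_def)
    have Ws: "W x y z \<circ> transpose i (Suc i) = W x z y" for x y z
      using assms by (auto simp: W_def fun_eq_iff transpose_def)
    have so: "sort_at i g (W x y z) = (if z < y then g (W x z y) else g (W x y z))"
      if "inj (W x y z)" for x y z and g :: "(nat \<Rightarrow> nat) \<Rightarrow> 'a"
      using that unfolding sort_at_def Suc_eq_plus1[symmetric] Ws Wi by simp
    note ni = three_positions_not_in_image(1)[OF lt, of w, folded W_def, OF inj]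
    have sp: "no_value_between w a i x z \<longleftrightarrow> no_value_between w a i x y \<and> no_value_between w a i y z"
      if "x < y" "y < z" "y \<in> {p, q, r}" for x y z
      using no_value_between_split[of x y z w a i] that ni by blast
    have dist: "p \<noteq> q" "q \<noteq> r" "p \<noteq> r"
      using True assms by (simp_all add: p_q_r_def inj_eq)
    consider "p < q" "q < r" | "p < r" "r < q" | "q < p" "p < r" | "q < r" "r < p" | "r < p" "p < q" | "r < q" "q < p"
      using dist by (meson linorder_neqE_nat)
    then show ?thesis
    proof cases
      case 1
      then have "p < r" "\<not> q < p" "\<not> r < q" "\<not> r < p" by auto
      then show ?thesis
        unfolding w using 1 by (simp add: cd so inj injs sp[of p q r])
    next
      case 2
      then have "p < q" "\<not> r < p" "\<not> q < r" "\<not> q < p" by auto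
      then show ?thesis
        unfolding w using 2 by (simp add: cd so inj injs sp[of p r q])
    next
      case 3
      then have "q < r" "\<not> p < q" "\<not> r < p" "\<not> r < q" by auto
      then show ?thesis
        unfolding w using 3 by (simp add: cd so inj injs sp[of q p r])
    next
      case 4
      then have "q < p" "\<not> r < q" "\<not> p < r" "\<not> p < q" by auto
      then show ?thesis
        unfolding w using 4 by (simp add: cd so inj injs sp[of q r p])
    next
      case 5
      then have "r < q" "\<not> p < r" "\<not> q < p" "\<not> q < r" by auto
      then show ?thesis
        unfolding w using 5 by (simp add: cd so inj injs sp[of r p q])
    next
      case 6
      then have "r < p" "\<not> q < r" "\<not> p < q" "\<not> p < r" by auto
      then show ?thesis
        unfolding w using 6 by (simp add: cd so inj injs sp[of r q p])
    qed
  qed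
qed

text \<open>
  The Yang-Baxter relation for \<open>1 - \<tau>\<close>. In degree two it is the sum of the two classical relations
  \<open>\<tau>\<^sub>1\<^sub>2 \<tau>\<^sub>2\<^sub>3 = \<tau>\<^sub>2\<^sub>3 \<tau>\<^sub>1\<^sub>3 + \<tau>\<^sub>1\<^sub>3 \<tau>\<^sub>1\<^sub>2\<close> and its mirror image between Bruhat operators, and in degree
  three both products lead from increasing to decreasing order of the three entries.
\<close>

lemma cover_diff_yang_baxter:
  assumes "Suc a < b"
  shows "cover_diff a (Suc a) (cover_diff a b (cover_diff (Suc a) b f)) =
         cover_diff (Suc a) b (cover_diff a b (cover_diff a (Suc a) f))"
proof
  fix w :: "nat \<Rightarrow> nat"
  define p q r where "p = w a" "q = w (Suc a)" "r = w b"
  define W where "W p q r = w(a := p, Suc a := q, b := r)" for p q r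
  have w: "w = W p q r"
    by (simp add: W_def p_q_r_def)
  show "cover_diff a (Suc a) (cover_diff a b (cover_diff (Suc a) b f)) w =
         cover_diff (Suc a) b (cover_diff a b (cover_diff a (Suc a) f)) w"
  proof (cases "inj w")
    case False
    then show ?thesis
      by (simp add: not_inj_cover_diff)
  next
    case True
    have inj: "inj (W p q r)" using True w by simp
    have lt: "a < Suc a" "Suc a < b" using assms by auto
    note swaps = inj_three_positions[OF lt, of w, folded W_def]
    have injs: "inj (W p r q)" "inj (W q p r)" "inj (W q r p)" "inj (W r p q)" "inj (W r q p)"
      using inj swaps by blast+
    have trivial: "no_value_between w a (Suc a) x y" for x y
      by (auto simp: no_value_between_def)
    have cd: "cover_diff a (Suc a) g (W x y z) = g (W x y z) -
           (if x < y then g (W y x z) else 0)"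
         "cover_diff (Suc a) b g (W x y z) = g (W x y z) -
           (if y < z \<and> no_value_between w (Suc a) b y z then g (W x z y) else 0)"
         "cover_diff a b g (W x y z) = g (W x y z) -
           (if x < z \<and> no_value_between w (Suc a) b x z \<and> \<not> (x < y \<and> y < z) then g (W z y x) else 0)"
         if "inj (W x y z)" for x y z and g :: "(nat \<Rightarrow> nat) \<Rightarrow> 'a"
      using cover_diff_three_positions[OF lt, of w, folded W_def, OF that, of g] by (auto simp: trivial)
    note ni = three_positions_not_in_image(2)[OF lt, of w, folded W_def, OF inj]
    have sp: "no_value_between w (Suc a) b x z \<longleftrightarrow>
        no_value_between w (Suc a) b x y \<and> no_value_between w (Suc a) b y z"
      if "x < y" "y < z" "y \<in> {p, q, r}" for x y z
      using no_value_between_split[of x y z w "Suc a" b] that ni by blast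
    have dist: "p \<noteq> q" "q \<noteq> r" "p \<noteq> r"
      using True assms by (simp_all add: p_q_r_def inj_eq)
    consider "p < q" "q < r" | "p < r" "r < q" | "q < p" "p < r" | "q < r" "r < p" | "r < p" "p < q" | "r < q" "q < p"
      using dist by (meson linorder_neqE_nat)
    then show ?thesis
    proof cases
      case 1
      then have "p < r" "\<not> q < p" "\<not> r < q" "\<not> r < p" by auto
      then show ?thesis
        unfolding w using 1 by (simp add: cd inj injs sp[of p q r])
    next
      case 2
      then have "p < q" "\<not> r < p" "\<not> q < r" "\<not> q < p" by auto
      then show ?thesis
        unfolding w using 2 by (simp add: cd inj injs sp[of p r q])
    next
      case 3
      then have "q < r" "\<not> p < q" "\<not> r < p" "\<not> r < q" by auto
      then show ?thesis
        unfolding w using 3 by (simp add: cd inj injs sp[of q p r])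
    next
      case 4
      then have "q < p" "\<not> r < q" "\<not> p < r" "\<not> p < q" by auto
      then show ?thesis
        unfolding w using 4 by (simp add: cd inj injs sp[of q r p])
    next
      case 5
      then have "r < q" "\<not> p < r" "\<not> q < p" "\<not> q < r" by auto
      then show ?thesis
        unfolding w using 5 by (simp add: cd inj injs sp[of r p q])
    next
      case 6
      then have "r < p" "\<not> q < r" "\<not> p < q" "\<not> p < r" by auto
      then show ?thesis
        unfolding w using 6 by (simp add: cd inj injs sp[of r q p])
    qed
  qed
qed

section \<open>A row of cover operators\<close>

lemma row_diff_Nil [simp]: "row_diff k [] f = f"
  by (simp add: row_diff_def)

lemma row_diff_Cons [simp]: "row_diff k (b # bs) f = cover_diff k b (row_diff k bs f)"
  by (simp add: row_diff_def)

lemma row_diff_append: "row_diff k (bs @ cs) f = row_diff k bs (row_diff k cs f)"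
  by (simp add: row_diff_def)

lemma row_diff_additive:
  assumes "\<And>x y. h (x - y) = h x - h y"
  shows "row_diff k bs (\<lambda>v. h (f v)) w = h (row_diff k bs f w)"
  by (induction bs arbitrary: w) (simp_all add: cover_diff_def assms)

text \<open>
  Every cover in row \<open>k\<close> raises the value in position \<open>k\<close>, so the operator is unitriangular for this
  value. The predicate \<open>I\<close> restricts attention to the permutations that can be reached from \<open>w\<close>.
\<close>

lemma row_diff_cong_above:
  assumes closed: "\<And>v b. I v \<Longrightarrow> b \<in> set bs \<Longrightarrow> covers v k b \<Longrightarrow> I (v \<circ> transpose k b)"
    and eq: "\<And>v. I v \<Longrightarrow> w k < v k \<Longrightarrow> f v = g v"
    and "I w"
  shows "row_diff k bs f w - row_diff k bs g w = f w - g w"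
proof -
  have "row_diff k bs f v - row_diff k bs g v = f v - g v" if "I v" "w k \<le> v k" for v
    using that closed
  proof (induction bs arbitrary: v)
    case (Cons b bs)
    have IH: "row_diff k bs f u - row_diff k bs g u = f u - g u" if "I u" "w k \<le> u k" for u
      using Cons.IH[OF that] Cons.prems(3) by simp
    show ?case
    proof (cases "covers v k b")
      case True
      let ?u = "v \<circ> transpose k b"
      have "I ?u" by (rule Cons.prems(3)) (use Cons.prems(1) True in simp_all)
      moreover have "w k < ?u k"
        using True Cons.prems(2) by (simp add: covers_def)
      ultimately have "row_diff k bs f ?u = row_diff k bs g ?u"
        using IH[of ?u] eq[of ?u] by simp
      then show ?thesis
        using True IH[OF Cons.prems(1,2)] by (simp add: cover_diff_def algebra_simps)
    next
      case False
      then show ?thesis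
        using IH[OF Cons.prems(1,2)] by (simp add: cover_diff_def)
    qed
  qed simp
  then show ?thesis using \<open>I w\<close> by simp
qed

lemma row_diff_sort_at_apart:
  assumes "k < i" "\<And>b. b \<in> set bs \<Longrightarrow> b < i \<or> i + 1 < b"
  shows "row_diff k bs (sort_at i f) = sort_at i (row_diff k bs f)"
  using assms(2) by (induction bs) (simp_all add: cover_diff_sort_at[OF assms(1)])

text \<open>The product \<open>R\<^sub>k = (1 - \<tau>\<^sub>k\<^sub>,\<^sub>n) \<dots> (1 - \<tau>\<^sub>k\<^sub>,\<^sub>k\<^sub>+\<^sub>1)\<close>.\<close>

definition monk_row :: "nat \<Rightarrow> nat \<Rightarrow> ((nat \<Rightarrow> nat) \<Rightarrow> 'r) \<Rightarrow> (nat \<Rightarrow> nat) \<Rightarrow> 'r::ab_group_add" where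
  "monk_row n k = row_diff k (rev [Suc k..<Suc n])"

lemma monk_row_sort_at:
  assumes "k < i" "i < n"
  shows "monk_row n k (sort_at i f) = sort_at i (monk_row n k f)"
proof -
  have "[Suc k..<Suc n] = [Suc k..<i] @ i # (i + 1) # [i + 2..<Suc n]"
    using assms upt_add_eq_append[of "Suc k" i "Suc n - i"] by (simp add: upt_conv_Cons)
  then have split: "rev [Suc k..<Suc n] = rev [i + 2..<Suc n] @ (i + 1) # i # rev [Suc k..<i]"
    by simp
  show ?thesis
    unfolding monk_row_def split row_diff_append row_diff_Cons
    by (subst row_diff_sort_at_apart, use assms in simp, force,
        subst cover_diff_sort_at_adjacent[OF assms(1), unfolded Suc_eq_plus1],
        subst row_diff_sort_at_apart, use assms in simp, force, rule refl)
qed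

lemma row_diff_commute:
  assumes "a + 1 < b" "b \<notin> set bs" "\<And>c. c \<in> set bs \<Longrightarrow> a + 1 < c"
  shows "cover_diff a b (row_diff (a + 1) bs f) = row_diff (a + 1) bs (cover_diff a b f)"
    and "cover_diff (a + 1) b (row_diff a bs f) = row_diff a bs (cover_diff (a + 1) b f)"
proof -
  have 1: "cover_diff a b (cover_diff (a + 1) c g) = cover_diff (a + 1) c (cover_diff a b g)"
    if "b \<noteq> c" "a + 1 < c" for c and g :: "(nat \<Rightarrow> nat) \<Rightarrow> 'a"
    by (rule cover_diff_commute) (use assms(1) that in auto)
  show "cover_diff a b (row_diff (a + 1) bs f) = row_diff (a + 1) bs (cover_diff a b f)"
    using assms(2,3) by (induction bs) (use 1 in auto)
  have 2: "cover_diff (a + 1) b (cover_diff a c g) = cover_diff a c (cover_diff (a + 1) b g)"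
    if "b \<noteq> c" "a + 1 < c" for c and g :: "(nat \<Rightarrow> nat) \<Rightarrow> 'a"
    by (rule cover_diff_commute) (use assms(1) that in auto)
  show "cover_diff (a + 1) b (row_diff a bs f) = row_diff a bs (cover_diff (a + 1) b f)"
    using assms(2,3) by (induction bs) (use 2 in auto)
qed

text \<open>
  Moving \<open>1 - \<tau>\<^sub>a\<^sub>,\<^sub>a\<^sub>+\<^sub>1\<close> through two rows: operators of different rows and different columns commute, so
  the two rows can be interleaved column by column, and each column is one Yang-Baxter relation.
\<close>

lemma row_diff_yang_baxter:
  assumes "distinct bs" "\<And>b. b \<in> set bs \<Longrightarrow> a + 1 < b"
  shows "cover_diff a (a + 1) (row_diff a bs (row_diff (a + 1) bs f)) =
         row_diff (a + 1) bs (row_diff a bs (cover_diff a (a + 1) f))"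
  using assms
proof (induction bs)
  case (Cons b bs)
  have b: "a + 1 < b" "b \<notin> set bs" and bs: "\<And>c. c \<in> set bs \<Longrightarrow> a + 1 < c"
    using Cons.prems by auto
  let ?c = "cover_diff a (a + 1)"
  have "?c (row_diff a (b # bs) (row_diff (a + 1) (b # bs) f)) =
      ?c (cover_diff a b (cover_diff (a + 1) b (row_diff a bs (row_diff (a + 1) bs f))))"
    unfolding row_diff_Cons by (simp only: row_diff_commute(2)[OF b bs])
  also have "\<dots> = cover_diff (a + 1) b (cover_diff a b (?c (row_diff a bs (row_diff (a + 1) bs f))))"
    by (rule cover_diff_yang_baxter[unfolded Suc_eq_plus1]) (fact b(1))
  also have "?c (row_diff a bs (row_diff (a + 1) bs f)) =
      row_diff (a + 1) bs (row_diff a bs (?c f))"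
    by (rule Cons.IH) (use Cons.prems in auto)
  also have "cover_diff a b (row_diff (a + 1) bs (row_diff a bs (?c f))) =
      row_diff (a + 1) bs (cover_diff a b (row_diff a bs (?c f)))"
    by (rule row_diff_commute(1)[OF b bs])
  finally show ?case
    unfolding row_diff_Cons .
qed simp

text \<open>
  Let \<open>u\<close> have an ascent at \<open>a\<close>. A path from \<open>u\<close> in row \<open>a\<close> cannot lift the value in position \<open>a\<close> past
  the value in position \<open>a + 1\<close>, since that value would then lie in between. Exchanging the two positions
  turns it into a path in row \<open>a + 1\<close>. The paths in row \<open>a + 1\<close> that do pass the other value end
  in an ascent at \<open>a\<close>, where \<open>g\<close> vanishes, and they never return.
\<close>

lemma row_diff_transfer:
  fixes f g :: "(nat \<Rightarrow> nat) \<Rightarrow> 'r::ab_group_add"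
  assumes bs: "\<And>b. b \<in> set bs \<Longrightarrow> a + 1 < b"
    and f: "\<And>v. inj v \<Longrightarrow> v a < v (a + 1) \<Longrightarrow> f v = g (v \<circ> transpose a (a + 1))"
    and g: "\<And>v. inj v \<Longrightarrow> v a < v (a + 1) \<Longrightarrow> g v = 0"
    and u: "inj u" "u a < u (a + 1)"
  shows "row_diff a bs f u = row_diff (a + 1) bs g (u \<circ> transpose a (a + 1))"
    and "row_diff (a + 1) bs g u = 0"
proof -
  let ?s = "transpose a (a + 1)"
  have zero: "row_diff (a + 1) bs g v = 0" if "inj v" "v a < v (a + 1)"
    "\<And>b. b \<in> set bs \<Longrightarrow> a + 1 < b" for v bs
    using that
  proof (induction bs arbitrary: v)
    case Nil
    then show ?case using g by simp
  next
    case (Cons b bs)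
    have b: "a + 1 < b" and IH: "row_diff (a + 1) bs g v = 0" if "inj v" "v a < v (a + 1)" for v
      using Cons.IH[OF that] Cons.prems(3) by auto
    have "row_diff (a + 1) bs g (v \<circ> transpose (a + 1) b) = 0" if "covers v (a + 1) b"
    proof (rule IH)
      show "inj (v \<circ> transpose (a + 1) b)" unfolding inj_comp_transpose by (fact Cons.prems(1))
      show "(v \<circ> transpose (a + 1) b) a < (v \<circ> transpose (a + 1) b) (a + 1)"
        using that b[OF Cons.prems(1,2)] Cons.prems(2) by (simp add: covers_def)
    qed
    then show ?case
      using IH[OF Cons.prems(1,2)] by (simp add: cover_diff_def)
  qed
  show "row_diff (a + 1) bs g u = 0"
    by (rule zero) (use u bs in auto)
  show "row_diff a bs f u = row_diff (a + 1) bs g (u \<circ> ?s)"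
    using bs u
  proof (induction bs arbitrary: u)
    case Nil
    show ?case unfolding row_diff_Nil by (rule f) (fact Nil)+
  next
    case (Cons b bs)
    have b: "a + 1 < b" and bs: "\<And>c. c \<in> set bs \<Longrightarrow> a + 1 < c"
      using Cons.prems(1) by auto
    have IH: "row_diff a bs f v = row_diff (a + 1) bs g (v \<circ> ?s)" if "inj v" "v a < v (a + 1)" for v
      by (rule Cons.IH) (use that bs in auto)
    note u = \<open>inj u\<close> \<open>u a < u (a + 1)\<close>
    have us: "(u \<circ> ?s) (a + 1) = u a" "(u \<circ> ?s) b = u b" "(u \<circ> ?s) a = u (a + 1)"
      using b by auto
    have below: "covers u a b \<longleftrightarrow> covers (u \<circ> ?s) (a + 1) b \<and> \<not> (u a < u (a + 1) \<and> u (a + 1) < u b)"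
    proof -
      have "{a<..<b} = insert (a + 1) {a + 1<..<b}" using b by auto
      moreover have "(u \<circ> ?s) c = u c" if "c \<in> {a + 1<..<b}" for c using that by auto
      ultimately show ?thesis
        unfolding covers_def us inj_comp_transpose by auto
    qed
    show ?case
    proof (cases "covers (u \<circ> ?s) (a + 1) b")
      case no: False
      then show ?thesis
        using IH[OF u] below unfolding row_diff_Cons cover_diff_def by simp
    next
      case yes: True
      show ?thesis
      proof (cases "u (a + 1) < u b")
        case True
        \<comment> \<open>The moving value passes \<open>u (a + 1)\<close>: this move is blocked on the left and has no weight on the right.\<close>
        have "row_diff (a + 1) bs g (u \<circ> ?s \<circ> transpose (a + 1) b) = 0"
        proof (rule zero)
          show "inj (u \<circ> ?s \<circ> transpose (a + 1) b)" unfolding inj_comp_transpose by (fact u(1))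
          show "(u \<circ> ?s \<circ> transpose (a + 1) b) a < (u \<circ> ?s \<circ> transpose (a + 1) b) (a + 1)"
            using True b by simp
        qed (fact bs)
        then show ?thesis
          using IH[OF u] below yes True u(2) unfolding row_diff_Cons cover_diff_def by simp
      next
        case False
        let ?v = "u \<circ> transpose a b"
        have "covers u a b" using below yes False by simp
        moreover have "u b < u (a + 1)"
          using False inj_eq[OF u(1), of "a + 1" b] b by simp
        moreover have "inj ?v" unfolding inj_comp_transpose by (fact u(1))
        moreover have "?v \<circ> ?s = u \<circ> ?s \<circ> transpose (a + 1) b"
          using b by (auto simp: fun_eq_iff transpose_def)
        ultimately show ?thesis
          using IH[OF u] IH[of ?v] yes b unfolding row_diff_Cons cover_diff_def by simp
      qed
    qed
  qed
qed

section \<open>Families obeying the Monk formula\<close>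

lemma permutes_comp_transpose:
  assumes "w permutes {1..n}" "1 \<le> a" "a \<le> n" "1 \<le> b" "b \<le> n"
  shows "w \<circ> transpose a b permutes {1..n}"
  by (rule permutes_compose[OF permutes_swap_id assms(1)]) (use assms in auto)

text \<open>The first \<open>k - 1\<close> rows have been climbed; this is the situation at the start of row \<open>k\<close>.\<close>

definition top_prefix :: "nat \<Rightarrow> nat \<Rightarrow> (nat \<Rightarrow> nat) \<Rightarrow> bool" where
  "top_prefix n k w \<longleftrightarrow> (\<forall>j \<in> {1..<k}. w j = n + 1 - j)"

lemma top_prefix_mono: "top_prefix n k w \<Longrightarrow> j \<le> k \<Longrightarrow> top_prefix n j w"
  by (auto simp: top_prefix_def)

lemma top_prefix_Suc: "top_prefix n (k + 1) w \<longleftrightarrow> top_prefix n k w \<and> (1 \<le> k \<longrightarrow> w k = n + 1 - k)"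
  by (auto simp: top_prefix_def less_Suc_eq)

lemma top_prefix_comp_transpose:
  assumes "top_prefix n k w" "k \<le> a" "k \<le> b"
  shows "top_prefix n k (w \<circ> transpose a b)"
  using assms by (auto simp: top_prefix_def)

lemma swap_adjacent:
  assumes "w permutes {1..n}" "1 \<le> i" "i < n" "top_prefix n k w" "k \<le> i"
  shows "w \<circ> transpose i (i + 1) permutes {1..n}" "top_prefix n k (w \<circ> transpose i (i + 1))"
  using permutes_comp_transpose[of w n i "i + 1"] top_prefix_comp_transpose[of n k w i "i + 1"] assms
  by simp_all

lemma top_prefix_le:
  assumes "w permutes {1..n}" "top_prefix n k w" "1 \<le> k" "k \<le> m"
  shows "m \<le> n \<Longrightarrow> w m \<le> n + 1 - k"
proof (rule ccontr)
  assume "m \<le> n" and gt: "\<not> w m \<le> n + 1 - k"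
  have "w m \<in> {1..n}"
    using permutes_in_image[OF assms(1), of m] assms(3,4) \<open>m \<le> n\<close> by simp
  then have j: "n + 1 - w m \<in> {1..<k}"
    using gt by auto
  then have "w (n + 1 - w m) = w m"
    using assms(2) \<open>w m \<in> {1..n}\<close> unfolding top_prefix_def by auto
  then have "n + 1 - w m = m"
    using permutes_inj[OF assms(1)] by (simp add: inj_eq)
  then show False
    using j assms(4) by simp
qed

lemma row_diff_no_covers:
  "(\<And>b. b \<in> set bs \<Longrightarrow> \<not> covers w k b) \<Longrightarrow> row_diff k bs f w = f w"
  by (induction bs) (simp_all add: cover_diff_def)

lemma monk_row_additive:
  assumes "\<And>x y. h (x - y) = h x - h y"
  shows "monk_row n k (\<lambda>v. h (f v)) w = h (monk_row n k f w)"
  unfolding monk_row_def using assms by (rule row_diff_additive)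

lemma monk_row_split:
  assumes "a < n"
  shows "monk_row n a f = row_diff a (rev [a + 2..<Suc n]) (cover_diff a (a + 1) f)"
proof -
  have "[Suc a..<Suc n] = (a + 1) # [a + 2..<Suc n]"
    using assms by (simp add: upt_conv_Cons)
  then show ?thesis
    by (simp add: monk_row_def row_diff_append del: upt_Suc)
qed

lemma monk_row_cong_above:
  assumes w: "w permutes {1..n}" "top_prefix n j w" "1 \<le> j" "j \<le> k" "k \<le> n"
    and P: "P w" "\<And>v b. P v \<Longrightarrow> k < b \<Longrightarrow> covers v k b \<Longrightarrow> P (v \<circ> transpose k b)"
    and eq: "\<And>v. v permutes {1..n} \<Longrightarrow> top_prefix n j v \<Longrightarrow> P v \<Longrightarrow> w k < v k \<Longrightarrow> f v = g v"
  shows "monk_row n k f w - monk_row n k g w = f w - g w"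
  unfolding monk_row_def
proof (rule row_diff_cong_above[where I = "\<lambda>v. v permutes {1..n} \<and> top_prefix n j v \<and> P v"])
  fix v b
  assume v: "v permutes {1..n} \<and> top_prefix n j v \<and> P v" and cov: "covers v k b"
    and b: "b \<in> set (rev [Suc k..<Suc n])"
  then have "k < b" "b \<le> n" by auto
  then show "v \<circ> transpose k b permutes {1..n} \<and> top_prefix n j (v \<circ> transpose k b) \<and>
      P (v \<circ> transpose k b)"
    using v w P(2)[of v b] cov permutes_comp_transpose[of v n k b] top_prefix_comp_transpose[of n j v k b]
    by auto
qed (use w P eq in auto)

text \<open>
  What is needed of the chain sums. By \<open>top\<close>, exchanging two neighbouring maximal values starts
  the induction: there \<open>F w\<close> is symmetric in \<open>X i\<close> and \<open>X (i + 1)\<close> up to one factor \<open>X i\<close>.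
\<close>

locale monk_family =
  fixes n :: nat and F :: "(nat \<Rightarrow> nat) \<Rightarrow> mpoly"
  assumes monk: "\<And>w k. w permutes {1..n} \<Longrightarrow> 1 \<le> k \<Longrightarrow> k \<le> n \<Longrightarrow> top_prefix n k w \<Longrightarrow>
      w k < n + 1 - k \<Longrightarrow> (1 - X k) * F w = monk_row n k F w"
    and top: "\<And>w i. w permutes {1..n} \<Longrightarrow> 1 \<le> i \<Longrightarrow> i < n \<Longrightarrow> top_prefix n (i + 2) w \<Longrightarrow>
      \<exists>H. swap_vars i H = H \<and> F w = X i * H"
begin

text \<open>
  By unitriangularity the two Monk formulas differ at \<open>w\<close> by \<open>f w - g w\<close>, so that
  \<open>(1 - X k) (f w - g w) = f w - g w\<close>, and \<open>X k\<close> can be cancelled.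
\<close>

lemma eq_if_same_monk:
  assumes "w permutes {1..n}" "top_prefix n j w" "1 \<le> j" "j \<le> k" "k \<le> n"
    and f: "(1 - X k) * f w = monk_row n k f w" and g: "(1 - X k) * g w = monk_row n k g w"
    and "P w" "\<And>v b. P v \<Longrightarrow> k < b \<Longrightarrow> covers v k b \<Longrightarrow> P (v \<circ> transpose k b)"
    and "\<And>v. v permutes {1..n} \<Longrightarrow> top_prefix n j v \<Longrightarrow> P v \<Longrightarrow> w k < v k \<Longrightarrow> f v = g v"
  shows "f w = g w"
proof -
  have "monk_row n k f w - monk_row n k g w = f w - g w"
    using assms(1-5,8-) by (rule monk_row_cong_above)
  then have "(1 - X k) * f w - (1 - X k) * g w = f w - g w"
    unfolding f g .
  moreover have "X k * (f w - g w) = (f w - g w) - ((1 - X k) * f w - (1 - X k) * g w)"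
    by (simp add: algebra_simps)
  ultimately have "X k * (f w - g w) = 0"
    by simp
  then have "f w - g w = 0"
    using X_neq_0 mult_eq_0_iff by blast
  then show ?thesis
    by (simp only: right_minus_eq)
qed

text \<open>
  The Monk formula of row \<open>i + 1\<close> holds before row \<open>i\<close> has been climbed, if there is a descent at \<open>i\<close>.
  Both sides satisfy the Monk formula of row \<open>i\<close>. For the right-hand side this says
  that \<open>R\<^sub>i\<^sub>+\<^sub>1 R\<^sub>i F\<close> and \<open>R\<^sub>i R\<^sub>i\<^sub>+\<^sub>1 F\<close> agree at \<open>v\<close>. By Yang-Baxter they differ only in the place of
  the factor \<open>1 - \<tau>\<^sub>i\<^sub>,\<^sub>i\<^sub>+\<^sub>1\<close>, which acts trivially at a descent, and row \<open>i\<close> preserves the descent.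
\<close>

lemma monk_second_row:
  assumes "v permutes {1..n}" "1 \<le> i" "i < n" "top_prefix n i v"
    and "v (i + 1) < v i" "v (i + 1) < n - i"
  shows "(1 - X (i + 1)) * F v = monk_row n (i + 1) F v"
  using assms
proof (induction "n - v i" arbitrary: v rule: less_induct)
  case less
  note v = less.prems
  have le: "v i \<le> n + 1 - i"
    by (rule top_prefix_le) (use v in auto)
  show ?case
  proof (cases "v i = n + 1 - i")
    case True
    then show ?thesis
      by (intro monk) (use v in \<open>auto simp: top_prefix_Suc[simplified]\<close>)
  next
    case False
    then have lt: "v i < n + 1 - i" using le by simp
    let ?Y = "1 - X i" and ?Z = "1 - X (i + 1)"
    let ?R = "row_diff i (rev [i + 2..<Suc n])"
    let ?P = "\<lambda>u. u (i + 1) < u i \<and> u (i + 1) = v (i + 1)"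
    have P_closed: "?P (u \<circ> transpose i b)" if "?P u" "i < b" "covers u i b" for u b
    proof -
      have "b \<noteq> i + 1" using that by (auto simp: covers_def)
      then show ?thesis using that by (auto simp: covers_def)
    qed
    show ?thesis
    proof (rule eq_if_same_monk[where j = i and k = i and w = v and P = ?P])
      show "?Y * (?Z * F v) = monk_row n i (\<lambda>u. ?Z * F u) v"
      proof -
        have "monk_row n i (\<lambda>u. ?Z * F u) v = ?Z * monk_row n i F v"
          by (rule monk_row_additive) (rule right_diff_distrib)
        then show ?thesis
          using monk[of v i] v lt by (simp add: mult.left_commute)
      qed
    next
      let ?G = "monk_row n (i + 1) F"
      have "?Y * ?G v = monk_row n (i + 1) (\<lambda>u. ?Y * F u) v"
        by (subst monk_row_additive) (simp_all add: right_diff_distrib)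
      also have "\<dots> = monk_row n (i + 1) (monk_row n i F) v"
      proof -
        have "monk_row n (i + 1) (\<lambda>u. ?Y * F u) v - monk_row n (i + 1) (monk_row n i F) v =
            ?Y * F v - monk_row n i F v"
          by (rule monk_row_cong_above[where j = i and P = "\<lambda>u. u i = v i"]) (use v lt in \<open>auto intro: monk\<close>)
        then show ?thesis using monk[of v i] v lt by simp
      qed
      also have "\<dots> = cover_diff i (i + 1) (?R ?G) v"
      proof -
        have "Suc (i + 1) = i + 2" by simp
        then show ?thesis
          unfolding monk_row_split[OF \<open>i < n\<close>] unfolding monk_row_def
          by (simp only:) (subst row_diff_yang_baxter, auto simp del: upt_Suc)
      qed
      also have "\<dots> = ?R ?G v"
        using v by (simp add: cover_diff_def covers_def)
      also have "\<dots> = monk_row n i ?G v"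
      proof -
        have "?R ?G v - ?R (cover_diff i (i + 1) ?G) v = ?G v - cover_diff i (i + 1) ?G v"
        proof (rule row_diff_cong_above[where I = ?P])
          show "?P (u \<circ> transpose i b)" if "?P u" "b \<in> set (rev [i + 2..<Suc n])" "covers u i b" for u b
            by (rule P_closed) (use that in auto)
        qed (use v in \<open>auto simp: cover_diff_def covers_def\<close>)
        moreover have "cover_diff i (i + 1) ?G v = ?G v"
          using v by (simp add: cover_diff_def covers_def)
        ultimately show ?thesis
          unfolding monk_row_split[OF \<open>i < n\<close>] by (simp only: right_minus_eq diff_self)
      qed
      finally show "?Y * ?G v = monk_row n i ?G v" .
    next
      fix u
      assume u: "u permutes {1..n}" "top_prefix n i u" "?P u" "v i < u i"
      have "u i \<le> n"
        using permutes_in_image[OF u(1), of i] v by simp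
      then show "?Z * F u = monk_row n (i + 1) F u"
        by (intro less.hyps) (use u v in auto)
    qed (use v P_closed in auto)
  qed
qed

text \<open>
  With the two largest available values in positions \<open>i\<close> and \<open>i + 1\<close>, the Monk formula at the sorted permutation
  has just two terms and reads \<open>X i * F (w \<circ> transpose i (i + 1)) = F w\<close>.
\<close>

lemma pi_op_top_pair:
  assumes w: "w permutes {1..n}" "1 \<le> i" "i < n" "top_prefix n (i + 2) w"
  shows "F (w \<circ> transpose i (i + 1)) = pi_op i (F w)"
proof -
  let ?u = "w \<circ> transpose i (i + 1)"
  have wi: "w i = n + 1 - i" "w (i + 1) = n - i"
    using w by (auto simp: top_prefix_def)
  have u: "?u permutes {1..n}" "top_prefix n i ?u"
    using swap_adjacent[OF w(1-3) top_prefix_mono[OF w(4), of i]] by simp_all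
  have inj: "inj ?u" using u(1) by (rule permutes_inj)
  have ui: "?u i = n - i" "?u (i + 1) = n + 1 - i"
    using wi by auto
  have "(1 - X i) * F ?u = monk_row n i F ?u"
    by (rule monk) (use u ui w in auto)
  also have "\<dots> = cover_diff i (i + 1) F ?u"
    unfolding monk_row_split[OF \<open>i < n\<close>]
  proof (rule row_diff_no_covers)
    fix b assume "b \<in> set (rev [i + 2..<Suc n])"
    then have b: "i + 2 \<le> b" "b \<le> n" by auto
    have "w b \<le> n + 1 - (i + 2)"
      by (rule top_prefix_le[OF w(1,4)]) (use b in auto)
    then have "?u b < ?u i"
      using b ui w(3) by simp
    then show "\<not> covers ?u i b"
      unfolding covers_def by simp
  qed
  also have "\<dots> = F ?u - F (?u \<circ> transpose i (i + 1))"
  proof -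
    have "?u i < ?u (i + 1)"
      unfolding ui using w(3) by linarith
    then have "covers ?u i (i + 1)"
      unfolding covers_def using inj by auto
    then show ?thesis
      unfolding cover_diff_def by presburger
  qed
  also have "\<dots> = F ?u - F w"
    by (simp only: comp_assoc transpose_comp_involutory comp_id)
  finally have "X i * F ?u = F w"
    by (simp add: algebra_simps)
  moreover obtain H where H: "swap_vars i H = H" "F w = X i * H"
    using top w by blast
  ultimately have "F ?u = H"
    using X_neq_0[of i] by (metis mult_left_cancel)
  then show ?thesis
    using H pi_op_X_mult_symmetric by simp
qed

text \<open>
  The case in which the exchanged positions start in the row under consideration, by induction on the
  value in position \<open>i + 1\<close>. Multiplied by \<open>1 - X i\<close>, the right-hand side becomes
  \<open>R\<^sub>i\<^sub>+\<^sub>1 (G - F)\<close> at \<open>w\<close>, where \<open>G\<close> is \<open>pi_op i\<close> after \<open>F\<close>. The left-hand side becomes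
  \<open>R\<^sub>i\<^sub>+\<^sub>1 (sort_at i F - F)\<close> at \<open>w\<close>, by matching paths of adjacent rows. By the induction hypothesis
  these differ only in the leading term.
\<close>

lemma pi_op_descent:
  assumes "w permutes {1..n}" "1 \<le> i" "i < n" "top_prefix n i w" "w (i + 1) < w i"
  shows "F (w \<circ> transpose i (i + 1)) = pi_op i (F w)"
  using assms
proof (induction "n - w (i + 1)" arbitrary: w rule: less_induct)
  case less
  note w = less.prems
  let ?s = "transpose i (i + 1)"
  have le: "w i \<le> n + 1 - i"
    by (rule top_prefix_le) (use w in auto)
  show ?case
  proof (cases "w (i + 1) = n - i")
    case True
    then have "w i = n + 1 - i"
      using le w(5) by simp
    then have "top_prefix n (i + 2) w"
      using w True by (auto simp: top_prefix_def less_Suc_eq)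
    then show ?thesis
      using w by (intro pi_op_top_pair)
  next
    case False
    then have lt: "w (i + 1) < n - i"
      using le w(5) by simp
    let ?u = "w \<circ> ?s" and ?Z = "1 - X (i + 1)"
    let ?bs = "rev [i + 2..<Suc n]"
    define G where "G v = pi_op i (F v)" for v
    define K where "K v = sort_at i F v - F v" for v
    have bs: "monk_row n (i + 1) = row_diff (i + 1) ?bs"
      by (simp add: monk_row_def)
    have inj: "inj w" using w(1) by (rule permutes_inj)
    have Fu: "F ?u = sort_at i F w"
      using inj w(5) by (simp add: sort_at_def)
    note u = swap_adjacent[OF w(1-4) order.refl]
    have "(1 - X i) * G w = pi_op i (?Z * F w) - ?Z * F w"
      unfolding G_def by (rule one_minus_X_mult_pi_op)
    also have "\<dots> = monk_row n (i + 1) (\<lambda>v. pi_op i (F v) - F v) w"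
      unfolding monk_second_row[OF w lt]
      by (rule monk_row_additive[where h = "\<lambda>f. pi_op i f - f", symmetric]) (simp add: pi_op_diff)
    finally have 1: "(1 - X i) * G w = monk_row n (i + 1) (\<lambda>v. G v - F v) w"
      unfolding G_def .
    have "(1 - X i) * F ?u = monk_row n i F ?u"
    proof (rule monk)
      have "w (i + 1) < n + 1 - i" using lt by simp
      then show "?u i < n + 1 - i" by simp
    qed (use u w in auto)
    also have "\<dots> = row_diff (i + 1) ?bs K (?u \<circ> ?s)"
      unfolding monk_row_split[OF \<open>i < n\<close>]
    proof (rule row_diff_transfer(1))
      fix v :: "nat \<Rightarrow> nat"
      assume v: "inj v" "v i < v (i + 1)"
      have "sort_at i F (v \<circ> ?s) = F (v \<circ> ?s \<circ> ?s)"
      proof -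
        have "inj (v \<circ> ?s)"
          unfolding inj_comp_transpose by (fact v(1))
        then show ?thesis
          unfolding sort_at_def using v(2) by simp
      qed
      then have "K (v \<circ> ?s) = F v - F (v \<circ> ?s)"
        by (simp add: K_def comp_assoc)
      moreover have "covers v i (i + 1)"
        using v by (auto simp: covers_def)
      ultimately show "cover_diff i (i + 1) F v = K (v \<circ> ?s)"
        unfolding cover_diff_def by presburger
      show "K v = 0"
        using v by (simp add: K_def sort_at_def)
    next
      show "inj ?u" unfolding inj_comp_transpose by (fact inj)
      show "?u i < ?u (i + 1)" using w(5) by simp
    qed auto
    also have "?u \<circ> ?s = w"
      by (simp add: comp_assoc)
    finally have 2: "(1 - X i) * F ?u = monk_row n (i + 1) K w"
      unfolding bs .
    have "monk_row n (i + 1) (\<lambda>v. G v - F v) w - monk_row n (i + 1) K w = (G w - F w) - K w"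
    proof (rule monk_row_cong_above[where j = i and P = "\<lambda>v. v i = w i"])
      fix v
      assume v: "v permutes {1..n}" "top_prefix n i v" "v i = w i" "w (i + 1) < v (i + 1)"
      have v_le: "v (i + 1) \<le> n" "v i \<le> n"
        using permutes_in_image[OF v(1), of "i + 1"] permutes_in_image[OF v(1), of i] w by auto
      have "inj v" using v(1) by (rule permutes_inj)
      have "G v = sort_at i F v"
      proof (cases "v (i + 1) < v i")
        case True
        then have "F (v \<circ> ?s) = pi_op i (F v)"
          by (intro less.hyps) (use v v_le w in auto)
        then show ?thesis
          using True \<open>inj v\<close> by (simp add: G_def sort_at_def)
      next
        case False
        let ?v = "v \<circ> ?s"
        have "v i \<noteq> v (i + 1)"
          using \<open>inj v\<close> by (simp add: inj_eq)
        note v' = swap_adjacent[OF v(1) w(2,3) v(2) order.refl]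
        have "F (?v \<circ> ?s) = pi_op i (F ?v)"
          by (intro less.hyps)
             (use v v' v_le w False \<open>v i \<noteq> v (i + 1)\<close> in auto)
        moreover have "?v \<circ> ?s = v"
          by (simp add: comp_assoc)
        ultimately show ?thesis
          using False by (simp add: G_def sort_at_def pi_op_idem)
      qed
      then show "G v - F v = K v"
        by (simp add: K_def)
    qed (use w in auto)
    also have "\<dots> = G w - F ?u"
      unfolding K_def Fu by simp
    finally have "(1 - X i) * G w - (1 - X i) * F ?u = G w - F ?u"
      unfolding 1 2 .
    moreover have "X i * (G w - F ?u) = (G w - F ?u) - ((1 - X i) * G w - (1 - X i) * F ?u)"
      by (simp only: left_diff_distrib right_diff_distrib mult_1) simp
    ultimately have "X i * (G w - F ?u) = 0"
      by (simp only: diff_self)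
    then have "G w - F ?u = 0"
      using X_neq_0 mult_eq_0_iff by blast
    then show ?thesis
      by (simp only: right_minus_eq G_def)
  qed
qed

lemma pi_op_sort_at_same_row:
  assumes w: "w permutes {1..n}" "1 \<le> i" "i < n" "top_prefix n i w"
  shows "pi_op i (F w) = sort_at i F w"
proof -
  have inj: "inj w" using w(1) by (rule permutes_inj)
  show ?thesis
  proof (cases "w (i + 1) < w i")
    case True
    then show ?thesis
      using pi_op_descent[OF w] inj by (simp add: sort_at_def)
  next
    case False
    let ?u = "w \<circ> transpose i (i + 1)"
    have "w i \<noteq> w (i + 1)"
      using inj by (simp add: inj_eq)
    then have "?u (i + 1) < ?u i"
      using False by simp
    then have "F (?u \<circ> transpose i (i + 1)) = pi_op i (F ?u)"
      using swap_adjacent[OF w order.refl] w by (intro pi_op_descent)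
    then have "F w = pi_op i (F ?u)"
      by (simp only: comp_assoc transpose_comp_involutory comp_id)
    then have "pi_op i (F w) = F w"
      by (metis pi_op_idem)
    then show ?thesis
      unfolding sort_at_def using False by simp
  qed
qed

text \<open>
  From row \<open>k + 1\<close> back to row \<open>k\<close>: both sides satisfy the Monk formula of row \<open>k\<close>, since \<open>1 - X k\<close>
  commutes with \<open>pi_op i\<close> and \<open>R\<^sub>k\<close> commutes with \<open>sort_at i\<close>.
\<close>

lemma pi_op_sort_at_step:
  assumes k: "1 \<le> k" "k < i" "i < n"
    and later: "\<And>v. v permutes {1..n} \<Longrightarrow> top_prefix n (k + 1) v \<Longrightarrow> pi_op i (F v) = sort_at i F v"
    and "w permutes {1..n}" "top_prefix n k w"
  shows "pi_op i (F w) = sort_at i F w"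
  using assms(5,6)
proof (induction "n - w k" arbitrary: w rule: less_induct)
  case less
  note w = less.prems
  have le: "w k \<le> n + 1 - k"
    by (rule top_prefix_le) (use w k in auto)
  show ?case
  proof (cases "w k = n + 1 - k")
    case True
    then show ?thesis
      using w by (intro later) (auto simp: top_prefix_Suc[simplified])
  next
    case False
    then have lt: "w k < n + 1 - k"
      using le by simp
    show ?thesis
    proof (rule eq_if_same_monk[where j = k and k = k and w = w and P = "\<lambda>_. True"])
      have "(1 - X k) * pi_op i (F w) = pi_op i ((1 - X k) * F w)"
        by (rule pi_op_symmetric_mult[symmetric]) (use k in \<open>simp add: swap_vars_diff swap_vars_X\<close>)
      also have "\<dots> = monk_row n k (\<lambda>v. pi_op i (F v)) w"
        unfolding monk_row_additive[of "pi_op i" n k F w, OF pi_op_diff]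
        using monk[of w k] w k lt by simp
      finally show "(1 - X k) * pi_op i (F w) = monk_row n k (\<lambda>v. pi_op i (F v)) w" .
    next
      define w' where "w' = (if inj w \<and> w (i + 1) < w i then w \<circ> transpose i (i + 1) else w)"
      have sort: "sort_at i f w = f w'" for f :: "(nat \<Rightarrow> nat) \<Rightarrow> mpoly"
        by (simp add: sort_at_def w'_def)
      have ik: "1 \<le> i" "k \<le> i" using k by simp_all
      have "w' permutes {1..n}" "top_prefix n k w'"
        using swap_adjacent[OF w(1) ik(1) k(3) w(2) ik(2)] w unfolding w'_def by presburger+
      moreover have "w' k = w k"
        using k by (simp add: w'_def)
      ultimately have "(1 - X k) * F w' = monk_row n k F w'"
        using k lt by (intro monk) simp_all
      then show "(1 - X k) * sort_at i F w = monk_row n k (sort_at i F) w"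
        unfolding monk_row_sort_at[OF k(2,3)] sort .
    next
      fix v
      assume v: "v permutes {1..n}" "top_prefix n k v" "w k < v k"
      have "v k \<le> n"
        using permutes_in_image[OF v(1), of k] k by simp
      then show "pi_op i (F v) = sort_at i F v"
        by (intro less.hyps) (use v in auto)
    qed (use w k in auto)
  qed
qed

lemma pi_op_sort_at:
  assumes "w permutes {1..n}" "1 \<le> i" "i < n"
  shows "pi_op i (F w) = sort_at i F w"
proof -
  have "\<forall>v. v permutes {1..n} \<longrightarrow> top_prefix n k v \<longrightarrow> pi_op i (F v) = sort_at i F v"
    if "k \<le> i" "1 \<le> k" for k
    using that
  proof (induction rule: inc_induct)
    case base
    show ?case
      using pi_op_sort_at_same_row[OF _ assms(2,3)] by simp
  next
    case (step k)
    show ?case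
    proof (intro allI impI)
      fix v
      assume "v permutes {1..n}" "top_prefix n k v"
      then show "pi_op i (F v) = sort_at i F v"
        using pi_op_sort_at_step[OF \<open>1 \<le> k\<close> \<open>k < i\<close> assms(3)] step.IH by simp
    qed
  qed
  from this[of 1] show ?thesis
    using assms by (simp add: top_prefix_def)
qed

end

section \<open>Lengths and reduced words\<close>

definition inversions :: "(nat \<Rightarrow> nat) \<Rightarrow> (nat \<times> nat) set" where
  "inversions w = {(i, j). i < j \<and> w j < w i}"

lemma ell_eq_card_inversions: "ell w = card (inversions w)"
  by (simp add: ell_def inversions_def)

lemma finite_inversions:
  assumes "w permutes {1..n}"
  shows "finite (inversions w)"
proof (rule finite_subset)
  show "inversions w \<subseteq> {1..n} \<times> {1..n}"
  proof
    fix p assume p: "p \<in> inversions w"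
    obtain i j where ij: "p = (i, j)" "i < j" "w j < w i"
      using p by (auto simp: inversions_def)
    have out: "x \<notin> {1..n} \<Longrightarrow> w x = x" for x
      using assms by (rule permutes_not_in)
    have in_range: "x \<in> {1..n} \<Longrightarrow> w x \<in> {1..n}" for x
      using permutes_in_image[OF assms] by blast
    have "j \<in> {1..n}"
      using out[of j] out[of i] in_range[of i] ij by (cases "i \<in> {1..n}"; cases "j \<in> {1..n}") auto
    moreover have "i \<in> {1..n}"
      using out[of i] ij \<open>j \<in> {1..n}\<close> by (cases "i \<in> {1..n}") auto
    ultimately show "p \<in> {1..n} \<times> {1..n}"
      using ij by simp
  qed
qed simp

text \<open>
  Applying the transposition to both members of a pair carries inversions to inversions, if it is only
  applied to those pairs whose order it preserves. What is missed is the pair \<open>(a, b)\<close>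
  and two pairs for each entry between the exchanged ones. So the length grows by one exactly
  when there is no such entry.
\<close>

lemma inversions_comp_transpose:
  assumes "w permutes {1..n}" "a < b" "w a < w b"
  defines "M \<equiv> {c \<in> {a<..<b}. w a < w c \<and> w c < w b}"
  shows "\<exists>A. card A = ell w \<and> finite A \<and>
    inversions (w \<circ> transpose a b) = A \<union> ({(a, b)} \<union> Pair a ` M \<union> (\<lambda>c. (c, b)) ` M) \<and>
    A \<inter> ({(a, b)} \<union> Pair a ` M \<union> (\<lambda>c. (c, b)) ` M) = {}"
proof -
  let ?t = "transpose a b"
  define g where "g = (\<lambda>(i, j). if ?t i < ?t j then (?t i, ?t j) else (i, j))"
  let ?E = "{(a, b)} \<union> Pair a ` M \<union> (\<lambda>c. (c, b)) ` M"
  have inj: "inj w" using assms(1) by (rule permutes_inj)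
  \<comment> \<open>The pairs whose order is reversed by the transposition.\<close>
  have rev: "\<not> ?t i < ?t j \<longleftrightarrow> i = a \<and> j = b \<or> i = a \<and> j \<in> {a<..<b} \<or> j = b \<and> i \<in> {a<..<b}"
    if "i < j" for i j
    using that assms(2) by (auto simp: transpose_def)
  have inj_g: "inj_on g {(i, j). i < j}"
  proof (rule inj_onI)
    fix p q assume "p \<in> {(i, j). i < j}" "q \<in> {(i, j). i < j}" "g p = g q"
    then show "p = q"
      by (cases p; cases q) (auto simp: g_def transpose_eq_iff split: if_splits)
  qed
  have "inversions (w \<circ> ?t) = g ` inversions w \<union> ?E \<and> g ` inversions w \<inter> ?E = {}"
  proof -
    have g_in: "(x, y) \<in> g ` inversions w \<longleftrightarrow>
        (if ?t x < ?t y then (?t x, ?t y) \<in> inversions w else (x, y) \<in> inversions w)" if "x < y" for x y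
    proof
      assume "(x, y) \<in> g ` inversions w"
      then show "if ?t x < ?t y then (?t x, ?t y) \<in> inversions w else (x, y) \<in> inversions w"
        by (auto simp: g_def inversions_def split: if_splits)
    next
      assume "if ?t x < ?t y then (?t x, ?t y) \<in> inversions w else (x, y) \<in> inversions w"
      then show "(x, y) \<in> g ` inversions w"
        using that
        by (auto simp: g_def image_iff split: if_splits
            intro: bexI[of _ "(?t x, ?t y)"] bexI[of _ "(x, y)"])
    qed
    have g_less: "(x, y) \<in> g ` inversions w \<Longrightarrow> x < y" for x y
      by (auto simp: g_def inversions_def split: if_splits)
    have E_less: "(x, y) \<in> ?E \<Longrightarrow> x < y" for x y
      using assms(2) by (auto simp: M_def)
    have ne: "w c \<noteq> w d" if "c \<noteq> d" for c d
      using inj that by (simp add: inj_eq)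
    have key: "((x, y) \<in> inversions (w \<circ> ?t) \<longleftrightarrow> (x, y) \<in> g ` inversions w \<or> (x, y) \<in> ?E) \<and>
        \<not> ((x, y) \<in> g ` inversions w \<and> (x, y) \<in> ?E)" if xy: "x < y" for x y
    proof (cases "?t x < ?t y")
      case True
      then have "(x, y) \<notin> ?E"
        using rev[OF xy] by (auto simp: M_def)
      moreover have "(x, y) \<in> inversions (w \<circ> ?t) \<longleftrightarrow> (x, y) \<in> g ` inversions w"
        using True that g_in[OF xy] by (simp add: inversions_def)
      ultimately show ?thesis by blast
    next
      case False
      then consider "x = a" "y = b" | "x = a" "y \<in> {a<..<b}" | "y = b" "x \<in> {a<..<b}"
        using rev[OF xy] by blast
      then show ?thesis
      proof cases
        case 1
        then show ?thesis
          using g_in[OF xy] False assms(2,3) by (simp add: inversions_def)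
      next
        case 2
        then show ?thesis
          using g_in[OF xy] False assms(2,3) ne[of y a] ne[of y b]
          by (auto simp: inversions_def M_def)
      next
        case 3
        then show ?thesis
          using g_in[OF xy] False assms(2,3) ne[of x a] ne[of x b]
          by (auto simp: inversions_def M_def)
      qed
    qed
    have "p \<in> inversions (w \<circ> ?t) \<longleftrightarrow> p \<in> g ` inversions w \<union> ?E"
      and "\<not> (p \<in> g ` inversions w \<and> p \<in> ?E)" for p
    proof -
      obtain x y where p: "p = (x, y)" by fastforce
      have less: "(x, y) \<in> inversions (w \<circ> ?t) \<Longrightarrow> x < y"
        by (simp add: inversions_def)
      show "p \<in> inversions (w \<circ> ?t) \<longleftrightarrow> p \<in> g ` inversions w \<union> ?E"
        unfolding p Un_iff[of _ "g ` inversions w"] using key[of x y] g_less[of x y] E_less[of x y] less by metis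
      show "\<not> (p \<in> g ` inversions w \<and> p \<in> ?E)"
        unfolding p using key[of x y] g_less[of x y] by metis
    qed
    then show ?thesis
      by (intro conjI set_eqI) (simp_all only: Int_iff empty_iff)
  qed
  moreover have "card (g ` inversions w) = ell w"
  proof -
    have "inversions w \<subseteq> {(i, j). i < j}"
      by (auto simp: inversions_def)
    then show ?thesis
      using inj_g by (simp add: card_image inj_on_subset ell_def inversions_def)
  qed
  moreover have "finite (g ` inversions w)"
    using finite_inversions[OF assms(1)] by simp
  ultimately show ?thesis by blast
qed

lemma ell_less_comp_transpose:
  assumes "w permutes {1..n}" "a < b" "w a < w b"
  shows "ell w < ell (w \<circ> transpose a b)"
    and "ell (w \<circ> transpose a b) = ell w + 1 \<longleftrightarrow> {c \<in> {a<..<b}. w a < w c \<and> w c < w b} = {}"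
proof -
  define M where "M = {c \<in> {a<..<b}. w a < w c \<and> w c < w b}"
  define E where "E = {(a, b)} \<union> Pair a ` M \<union> (\<lambda>c. (c, b)) ` M"
  obtain A where A: "card A = ell w" "finite A" "inversions (w \<circ> transpose a b) = A \<union> E" "A \<inter> E = {}"
  proof -
    obtain A where "card A = ell w \<and> finite A \<and> inversions (w \<circ> transpose a b) = A \<union> E \<and> A \<inter> E = {}"
      using inversions_comp_transpose[OF assms] unfolding M_def[symmetric] E_def[symmetric] by (rule exE)
    then show ?thesis
      by (intro that[of A]) (simp_all only:)
  qed
  have "finite E"
    by (simp add: E_def M_def)
  have card: "ell (w \<circ> transpose a b) = ell w + card E"
    unfolding ell_eq_card_inversions[of "w \<circ> transpose a b"] A(3) card_Un_disjoint[OF A(2) \<open>finite E\<close> A(4)] A(1) ..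
  have "(a, b) \<in> E"
    by (simp add: E_def)
  then show "ell w < ell (w \<circ> transpose a b)"
    unfolding card using \<open>finite E\<close> card_gt_0_iff[of E] by (metis empty_iff less_add_same_cancel1)
  have "card E = 1 \<longleftrightarrow> M = {}"
  proof
    assume "card E = 1"
    then obtain p where p: "E = {p}"
      by (rule card_1_singletonE)
    have "c \<notin> M" for c
    proof
      assume c: "c \<in> M"
      then have "(a, c) \<in> E"
        by (simp add: E_def)
      then have "(a, c) = (a, b)"
        using \<open>(a, b) \<in> E\<close> unfolding p by (simp only: singleton_iff)
      then show False
        using c by (simp add: M_def)
    qed
    then show "M = {}" by (metis equals0I)
  next
    assume "M = {}"
    then show "card E = 1"
      by (simp add: E_def)
  qed
  then show "ell (w \<circ> transpose a b) = ell w + 1 \<longleftrightarrow> {c \<in> {a<..<b}. w a < w c \<and> w c < w b} = {}"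
    unfolding card M_def[symmetric] by linarith
qed

lemma ell_comp_transpose_eq_Suc_iff:
  assumes "w permutes {1..n}" "1 \<le> a" "a < b" "b \<le> n"
  shows "ell (w \<circ> transpose a b) = ell w + 1 \<longleftrightarrow> covers w a b"
proof (cases "w a < w b")
  case True
  have "covers w a b \<longleftrightarrow> {c \<in> {a<..<b}. w a < w c \<and> w c < w b} = {}"
    unfolding covers_def using True permutes_inj[OF assms(1)] by blast
  then show ?thesis
    using ell_less_comp_transpose(2)[OF assms(1,3) True] by (simp only:)
next
  case False
  let ?v = "w \<circ> transpose a b"
  have "inj w" using assms(1) by (rule permutes_inj)
  then have "?v a < ?v b"
    using False inj_eq[of w a b] assms(3) by (simp add: not_less le_less)
  moreover have "?v permutes {1..n}"
    using assms by (intro permutes_comp_transpose) auto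
  ultimately have "ell ?v < ell (?v \<circ> transpose a b)"
    by (intro ell_less_comp_transpose(1)[OF _ assms(3)])
  moreover have "?v \<circ> transpose a b = w"
    by (simp add: comp_assoc)
  ultimately show ?thesis
    using False by (simp add: covers_def)
qed

lemma ell_inv:
  assumes "w permutes {1..n}"
  shows "ell (inv w) = ell w"
proof -
  have inv: "inv w (w x) = x" "w (inv w x) = x" for x
    using permutes_inverses[OF assms] by auto
  have "(x, y) \<in> inversions (inv w) \<longleftrightarrow> (x, y) \<in> (\<lambda>(i, j). (w j, w i)) ` inversions w" for x y
  proof
    assume "(x, y) \<in> inversions (inv w)"
    then have "(inv w y, inv w x) \<in> inversions w"
      unfolding inversions_def by (simp add: inv)
    then show "(x, y) \<in> (\<lambda>(i, j). (w j, w i)) ` inversions w"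
      by (rule rev_image_eqI) (simp add: inv)
  next
    assume "(x, y) \<in> (\<lambda>(i, j). (w j, w i)) ` inversions w"
    then obtain i j where "i < j" "w j < w i" "x = w j" "y = w i"
      unfolding inversions_def by auto
    then show "(x, y) \<in> inversions (inv w)"
      unfolding inversions_def by (simp add: inv)
  qed
  then have image: "inversions (inv w) = (\<lambda>(i, j). (w j, w i)) ` inversions w"
    by (intro set_eqI) (metis surj_pair)
  have "inj_on (\<lambda>(i, j). (w j, w i)) (inversions w)"
    by (rule inj_on_inverseI[where g = "\<lambda>(x, y). (inv w y, inv w x)"]) (simp add: inv split_beta)
  then show ?thesis
    unfolding ell_eq_card_inversions image by (rule card_image)
qed

lemma transpose_permutes: "1 \<le> i \<Longrightarrow> i < n \<Longrightarrow> transpose i (i + 1) permutes {1..n}" for i n :: nat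
  by (rule permutes_swap_id) auto

lemma ell_transpose_comp:
  assumes v: "v permutes {1..n}" and i: "1 \<le> i" "i < n"
  shows "inv v i < inv v (i + 1) \<Longrightarrow> ell (transpose i (i + 1) \<circ> v) = ell v + 1"
    and "inv v (i + 1) < inv v i \<Longrightarrow> ell v = ell (transpose i (i + 1) \<circ> v) + 1"
proof -
  let ?s = "transpose i (i + 1)"
  have less: "ell (?s \<circ> u) = ell u + 1" if u: "u permutes {1..n}" and "inv u i < inv u (i + 1)" for u
  proof -
    have "inv u permutes {1..n}"
      using u by (rule permutes_inv)
    moreover have "covers (inv u) i (i + 1)"
      using that(2) permutes_inj[OF permutes_inv[OF u]] by (simp add: covers_def)
    ultimately have "ell (inv u \<circ> ?s) = ell (inv u) + 1"
      using ell_comp_transpose_eq_Suc_iff[of "inv u" n i "i + 1"] i by simp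
    moreover have "inv (?s \<circ> u) = inv u \<circ> ?s"
      by (simp only: o_inv_distrib[OF bij_transpose permutes_bij[OF u]] inv_transpose_eq)
    moreover have "?s \<circ> u permutes {1..n}"
      using permutes_compose[OF u transpose_permutes[OF i]] .
    ultimately show ?thesis
      using ell_inv[OF u] ell_inv[of "?s \<circ> u" n] by simp
  qed
  show "inv v i < inv v (i + 1) \<Longrightarrow> ell (?s \<circ> v) = ell v + 1"
    using less v by blast
  assume desc: "inv v (i + 1) < inv v i"
  have "inv (?s \<circ> v) = inv v \<circ> ?s"
    by (simp only: o_inv_distrib[OF bij_transpose permutes_bij[OF v]] inv_transpose_eq)
  then have "inv (?s \<circ> v) i < inv (?s \<circ> v) (i + 1)"
    using desc by simp
  then have "ell (?s \<circ> (?s \<circ> v)) = ell (?s \<circ> v) + 1"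
    by (intro less permutes_compose[OF v transpose_permutes[OF i]])
  then show "ell v = ell (?s \<circ> v) + 1"
    by (simp add: comp_assoc[symmetric])
qed

definition word_product :: "nat list \<Rightarrow> nat \<Rightarrow> nat" where
  "word_product is = foldr (\<lambda>i u. transpose i (i + 1) \<circ> u) is id"

lemma word_product_permutes_ell:
  "set is \<subseteq> {1..<n} \<Longrightarrow> word_product is permutes {1..n} \<and> ell (word_product is) \<le> length is"
proof (induction "is")
  case Nil
  have no_inversions: "{(i, j). i < j \<and> id j < id i} = ({} :: (nat \<times> nat) set)"
    by auto
  have "ell id = 0"
    unfolding ell_def no_inversions by simp
  then have "ell (id :: nat \<Rightarrow> nat) \<le> length ([] :: nat list)"
    by (rule eq_imp_le[OF trans]) simp
  moreover have "word_product [] = id"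
    by (simp add: word_product_def)
  ultimately show ?case
    using permutes_id[of "{1..n}"] by metis
next
  case (Cons i "is")
  let ?u = "word_product is"
  have u: "?u permutes {1..n}" "ell ?u \<le> length is" and i: "1 \<le> i" "i < n"
    using Cons by auto
  have "inv ?u i \<noteq> inv ?u (i + 1)"
    using permutes_inj[OF permutes_inv[OF u(1)]] by (simp add: inj_eq)
  then have "ell (transpose i (i + 1) \<circ> ?u) \<le> ell ?u + 1"
    using ell_transpose_comp[OF u(1) i] by (cases "inv ?u i < inv ?u (i + 1)") auto
  then have "ell (transpose i (i + 1) \<circ> ?u) \<le> length (i # is)"
    using u(2) by simp
  moreover have "transpose i (i + 1) \<circ> ?u permutes {1..n}"
    using permutes_compose[OF u(1) transpose_permutes[OF i]] .
  moreover have "word_product (i # is) = transpose i (i + 1) \<circ> ?u"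
    by (simp only: word_product_def foldr_Cons o_apply)
  ultimately show ?case by metis
qed

lemma permutes_eq_id_if_no_descent:
  fixes v :: "nat \<Rightarrow> nat"
  assumes v: "v permutes {1..n}" and asc: "\<And>i. 1 \<le> i \<Longrightarrow> i < n \<Longrightarrow> v i < v (i + 1)"
  shows "v = id"
proof -
  have range: "1 \<le> v x \<and> v x \<le> n" if "1 \<le> x" "x \<le> n" for x
    using permutes_in_image[OF v, of x] that by simp
  have fixed: "v x = x" if "x = 0 \<or> n < x" for x
    by (rule permutes_not_in[OF v]) (use that in auto)
  have lower: "m \<le> n \<Longrightarrow> m \<le> v m" for m
  proof (induction m)
    case (Suc m)
    show ?case
    proof (cases "m = 0")
      case True
      then show ?thesis
        using range[of 1] Suc.prems by simp
    next
      case False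
      then have "v m < v (Suc m)"
        using asc[of m] Suc.prems by simp
      then show ?thesis
        using Suc by simp
    qed
  qed simp
  have upper: "v m \<le> m" if "m \<le> n" for m
    using that
  proof (induction rule: inc_induct)
    case base
    show ?case
      using range[of n] fixed[of 0] by (cases "n = 0") simp_all
  next
    case (step m)
    show ?case
    proof (cases "m = 0")
      case True
      then show ?thesis using fixed[of 0] by simp
    next
      case False
      then have "v m < v (Suc m)"
        using asc[of m] step.hyps by simp
      then show ?thesis
        using step.IH by simp
    qed
  qed
  show ?thesis
  proof
    fix m
    show "v m = id m"
    proof (cases "m \<le> n")
      case True
      then show ?thesis using lower[of m] upper[of m] by simp
    next
      case False
      then show ?thesis using fixed[of m] by simp
    qed
  qed
qed

lemma reduced_word_exists:
  assumes "v permutes {1..n}"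
  shows "\<exists>is. reduced_word n is v"
  using assms
proof (induction "ell v" arbitrary: v rule: less_induct)
  case less
  note v = less.prems
  show ?case
  proof (cases "\<forall>i. 1 \<le> i \<longrightarrow> i < n \<longrightarrow> inv v i < inv v (i + 1)")
    case True
    then have "inv v = id"
      by (intro permutes_eq_id_if_no_descent[OF permutes_inv[OF v]]) auto
    then have "v = id"
      using permutes_inv_inv[OF v] by (metis inv_id)
    moreover have "ell id = 0"
      using word_product_permutes_ell[of "[]" 0] by (simp add: word_product_def)
    ultimately have "reduced_word n [] v"
      by (simp add: reduced_word_def)
    then show ?thesis ..
  next
    case False
    then obtain i where i: "1 \<le> i" "i < n" and "\<not> inv v i < inv v (i + 1)"
      by blast
    moreover have "inv v i \<noteq> inv v (i + 1)"
      using permutes_inj[OF permutes_inv[OF v]] by (simp add: inj_eq)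
    ultimately have desc: "inv v (i + 1) < inv v i" by simp
    let ?u = "transpose i (i + 1) \<circ> v"
    have ell: "ell v = ell ?u + 1"
      by (rule ell_transpose_comp(2)[OF v i desc])
    moreover have "?u permutes {1..n}"
      using permutes_compose[OF v transpose_permutes[OF i]] .
    ultimately obtain "is" where "is": "reduced_word n is ?u"
      using less.hyps[of ?u] by auto
    have "transpose i (i + 1) \<circ> ?u = v"
      by (simp add: comp_assoc[symmetric])
    then have "reduced_word n (i # is) v"
      using "is" i ell by (simp add: reduced_word_def)
    then show ?thesis ..
  qed
qed

lemma omega0_omega0: "omega0 n (omega0 n i) = i"
  by (auto simp: omega0_def)

lemma omega0_permutes: "omega0 n permutes {1..n}"
proof (rule bij_imp_permutes)
  show "bij_betw (omega0 n) {1..n} {1..n}"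
    by (rule bij_betw_byWitness[where f' = "omega0 n"]) (auto simp: omega0_omega0, auto simp: omega0_def)
qed (auto simp: omega0_def)

lemma inv_omega0: "inv (omega0 n) = omega0 n"
  by (rule inv_unique_comp) (auto simp: omega0_omega0)

context monk_family
begin

text \<open>
  Reducedness forces every letter to lengthen the product of the letters to its right, hence to act at a descent
  of the permutation reached so far; there \<open>sort_at i\<close> is multiplication by the letter.
\<close>

lemma foldr_pi_op_reduced_word:
  "reduced_word n is v \<Longrightarrow> foldr pi_op is (F (omega0 n)) = F (omega0 n \<circ> inv v)"
proof (induction "is" arbitrary: v)
  case Nil
  then have "v = id" by (simp add: reduced_word_def)
  then show ?case by simp
next
  case (Cons i "is")
  let ?s = "transpose i (i + 1)" and ?u = "word_product is"
  have v: "v = ?s \<circ> ?u" and len: "ell v = length is + 1" and set: "set is \<subseteq> {1..<n}"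
    and i: "1 \<le> i" "i < n"
    using Cons.prems by (auto simp: reduced_word_def word_product_def)
  have u: "?u permutes {1..n}" "ell ?u \<le> length is"
    using word_product_permutes_ell[OF set] by auto
  have inv_u: "inv ?u permutes {1..n}"
    using u(1) by (rule permutes_inv)
  have "\<not> inv ?u (i + 1) < inv ?u i"
  proof
    assume "inv ?u (i + 1) < inv ?u i"
    then have "ell ?u = ell v + 1"
      unfolding v by (rule ell_transpose_comp(2)[OF u(1) i])
    then show False using u(2) len by simp
  qed
  moreover have "inv ?u i \<noteq> inv ?u (i + 1)"
    using permutes_inj[OF inv_u] by (simp add: inj_eq)
  ultimately have asc: "inv ?u i < inv ?u (i + 1)" by simp
  then have "length is = ell ?u"
    using ell_transpose_comp(1)[OF u(1) i] len v by simp
  then have "reduced_word n is ?u"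
    using set by (simp add: reduced_word_def word_product_def)
  have "foldr pi_op (i # is) (F (omega0 n)) = pi_op i (foldr pi_op is (F (omega0 n)))"
    by simp
  also have "foldr pi_op is (F (omega0 n)) = F (omega0 n \<circ> inv ?u)"
    using \<open>reduced_word n is ?u\<close> by (rule Cons.IH)
  also have "pi_op i (F (omega0 n \<circ> inv ?u)) = sort_at i F (omega0 n \<circ> inv ?u)"
    by (rule pi_op_sort_at[OF permutes_compose[OF inv_u omega0_permutes] i])
  also have "\<dots> = F (omega0 n \<circ> inv ?u \<circ> ?s)"
  proof -
    have "inj (omega0 n \<circ> inv ?u)"
      by (rule permutes_inj[OF permutes_compose[OF inv_u omega0_permutes]])
    moreover have "inv ?u i \<in> {1..n}" "inv ?u (i + 1) \<in> {1..n}"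
      using permutes_in_image[OF inv_u] i by auto
    then have "(omega0 n \<circ> inv ?u) (i + 1) < (omega0 n \<circ> inv ?u) i"
      using asc by (auto simp: omega0_def)
    ultimately show ?thesis
      unfolding sort_at_def by presburger
  qed
  also have "inv v = inv ?u \<circ> ?s"
    unfolding v by (simp only: o_inv_distrib[OF bij_transpose permutes_bij[OF u(1)]] inv_transpose_eq)
  then have "omega0 n \<circ> inv ?u \<circ> ?s = omega0 n \<circ> inv v"
    by (simp add: comp_assoc)
  finally show ?case .
qed

lemma grothendieck_eq:
  assumes "w permutes {1..n}" and F_omega0: "F (omega0 n) = xpow n (\<lambda>k. n - k)"
  shows "grothendieck n w = F w"
proof -
  let ?v = "inv w \<circ> omega0 n"
  have v: "?v permutes {1..n}"
    by (rule permutes_compose[OF omega0_permutes permutes_inv[OF assms(1)]])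
  have "inv ?v = omega0 n \<circ> w"
    using bij_imp_bij_inv[OF permutes_bij[OF assms(1)]] permutes_bij[OF omega0_permutes]
    by (simp add: o_inv_distrib inv_omega0 permutes_inv_inv[OF assms(1)])
  then have "omega0 n \<circ> inv ?v = omega0 n \<circ> omega0 n \<circ> w"
    by (simp only: comp_assoc)
  also have "omega0 n \<circ> omega0 n = id"
    by (simp add: fun_eq_iff omega0_omega0)
  finally have eq: "omega0 n \<circ> inv ?v = w"
    by (simp only: id_comp)
  have words: "foldr pi_op is (xpow n (\<lambda>k. n - k)) = F w" if "reduced_word n is ?v" for "is"
    by (rule foldr_pi_op_reduced_word[OF that, unfolded eq F_omega0])
  show ?thesis
    unfolding grothendieck_def pi_perm_def
  proof (rule the_equality)
    show "\<exists>is. reduced_word n is ?v \<and> F w = foldr pi_op is (xpow n (\<lambda>k. n - k))"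
      using words reduced_word_exists[OF v] by metis
    show "g = F w" if "\<exists>is. reduced_word n is ?v \<and> g = foldr pi_op is (xpow n (\<lambda>k. n - k))" for g
      using words that by blast
  qed
qed

end

section \<open>Monk formula for row sums\<close>

definition row_end :: "nat \<Rightarrow> (nat \<Rightarrow> nat) \<Rightarrow> nat list \<Rightarrow> nat \<Rightarrow> nat" where
  "row_end k w bs = foldl (\<lambda>v b. v \<circ> transpose k b) w bs"

lemma row_end_Nil [simp]: "row_end k w [] = w"
  and row_end_Cons: "row_end k w (b # bs) = row_end k (w \<circ> transpose k b) bs"
  by (simp_all add: row_end_def)

fun row_path :: "nat \<Rightarrow> (nat \<Rightarrow> nat) \<Rightarrow> nat list \<Rightarrow> bool" where
  "row_path k w [] \<longleftrightarrow> True"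
| "row_path k w (b # bs) \<longleftrightarrow> covers w k b \<and> row_path k (w \<circ> transpose k b) bs"

text \<open>
  The increasing runs in row \<open>k\<close>: for a fixed first entry \<open>k\<close> of the labels, increasing chains are those
  with decreasing second entries.
\<close>

definition falling_paths :: "nat \<Rightarrow> nat list \<Rightarrow> (nat \<Rightarrow> nat) \<Rightarrow> nat list set" where
  "falling_paths k bs w = {cs. sorted_wrt (>) cs \<and> set cs \<subseteq> set bs \<and> row_path k w cs}"

lemma finite_falling_paths: "finite (falling_paths k bs w)"
proof (rule finite_subset)
  show "falling_paths k bs w \<subseteq> {cs. set cs \<subseteq> set bs \<and> distinct cs}"
  proof -
    have "sorted_wrt (>) cs \<Longrightarrow> distinct cs" for cs :: "nat list"
      by (induction cs) auto
    then show ?thesis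
      by (auto simp: falling_paths_def)
  qed
  show "finite {cs. set cs \<subseteq> set bs \<and> distinct cs}"
    by (rule finite_subset_distinct) simp
qed

text \<open>
  Expanding the product of the \<open>1 - \<tau>\<^sub>k\<^sub>,\<^sub>b\<close> for decreasing \<open>b\<close> selects a decreasing list of columns.
\<close>

lemma row_diff_eq_sum_falling_paths:
  fixes f :: "(nat \<Rightarrow> nat) \<Rightarrow> 'r::ring_1"
  assumes "sorted_wrt (>) bs"
  shows "row_diff k bs f w = (\<Sum>cs \<in> falling_paths k bs w. (-1) ^ length cs * f (row_end k w cs))"
  using assms
proof (induction bs arbitrary: w)
  case Nil
  have "falling_paths k [] w = {[]}"
    by (auto simp: falling_paths_def)
  then show ?case by simp
next
  case (Cons b bs)
  have IH: "row_diff k bs f v = (\<Sum>cs \<in> falling_paths k bs v. (-1) ^ length cs * f (row_end k v cs))" for v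
    using Cons by simp
  let ?v = "w \<circ> transpose k b"
  let ?new = "if covers w k b then (#) b ` falling_paths k bs ?v else {}"
  have "cs \<in> falling_paths k (b # bs) w \<longleftrightarrow> cs \<in> falling_paths k bs w \<union> ?new" for cs
  proof (cases cs)
    case Nil
    then show ?thesis by (auto simp: falling_paths_def)
  next
    case [simp]: (Cons c cs')
    have below: "x < b" if "x \<in> set bs" for x
      using Cons.prems that by simp
    then have "b \<notin> set bs" by blast
    show ?thesis
    proof (cases "c = b")
      case True
      then show ?thesis
        using \<open>b \<notin> set bs\<close> below by (auto simp: falling_paths_def)
    next
      case False
      have "set cs \<subseteq> set bs \<longleftrightarrow> set cs \<subseteq> set (b # bs)" if "sorted_wrt (>) cs"
      proof -
        have "b \<notin> set cs'" if "c \<in> set (b # bs)"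
          using \<open>sorted_wrt (>) cs\<close> below[of c] that False by auto
        then show ?thesis
          using False by auto
      qed
      then show ?thesis
        using False by (auto simp: falling_paths_def)
    qed
  qed
  then have split: "falling_paths k (b # bs) w = falling_paths k bs w \<union> ?new"
    by (rule set_eqI)
  have "b \<notin> set bs" using Cons.prems by auto
  then have "falling_paths k bs w \<inter> ?new = {}"
    by (auto simp: falling_paths_def)
  then have "(\<Sum>cs \<in> falling_paths k (b # bs) w. (-1) ^ length cs * f (row_end k w cs)) =
      row_diff k bs f w + (\<Sum>cs \<in> ?new. (-1) ^ length cs * f (row_end k w cs))"
    unfolding split IH by (intro sum.union_disjoint) (simp_all add: finite_falling_paths)
  also have "(\<Sum>cs \<in> ?new. (-1) ^ length cs * f (row_end k w cs)) =
      (if covers w k b then - row_diff k bs f ?v else 0)"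
  proof -
    have "(-1) ^ length (b # cs) * f (row_end k w (b # cs)) = - ((-1) ^ length cs * f (row_end k ?v cs))" for cs
      unfolding row_end_Cons by simp
    note new = this
    have "(\<Sum>cs \<in> (#) b ` falling_paths k bs ?v. (-1) ^ length cs * f (row_end k w cs)) =
        (\<Sum>cs \<in> falling_paths k bs ?v. - ((-1) ^ length cs * f (row_end k ?v cs)))"
    proof (rule sum.reindex_cong[where l = "(#) b", OF _ refl])
      show "inj_on ((#) b) (falling_paths k bs ?v)" by simp
    qed (rule new)
    then show ?thesis
      unfolding IH sum_negf by simp
  qed
  finally show ?case
    by (simp add: cover_diff_def)
qed

text \<open>
  No position before \<open>k\<close> can take part in a cover, as its value exceeds all values in positions after \<open>k\<close>.
\<close>

lemma k_bruhat_cover_iff_covers: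
  assumes w: "w permutes {1..n}" "top_prefix n k w" and k: "1 \<le> k"
  shows "k_bruhat_cover n k w (a, b) \<longleftrightarrow> a = k \<and> k < b \<and> b \<le> n \<and> covers w k b"
proof -
  have "\<not> covers w a b" if "1 \<le> a" "a < k" "k < b" "b \<le> n"
  proof -
    have "w a = n + 1 - a"
      using w(2) that by (simp add: top_prefix_def)
    moreover have "w b \<le> n + 1 - k"
      by (rule top_prefix_le[OF w k]) (use that in auto)
    ultimately have "w b < w a"
      using that by linarith
    then show ?thesis
      by (simp add: covers_def)
  qed
  then show ?thesis
    using ell_comp_transpose_eq_Suc_iff[OF w(1), of a b] k
    unfolding k_bruhat_cover_def by (cases "a = k") auto
qed

lemma row_step:
  assumes w: "w permutes {1..n}" "top_prefix n k w" and k: "1 \<le> k" "k < b" "b \<le> n"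
  shows "w \<circ> transpose k b permutes {1..n}" "top_prefix n k (w \<circ> transpose k b)"
  using permutes_comp_transpose[OF w(1), of k b] top_prefix_comp_transpose[OF w(2), of k b] k by simp_all

lemma chain_end_Nil [simp]: "chain_end w [] = w"
  and chain_end_Cons: "chain_end w ((a, b) # c) = chain_end (w \<circ> transpose a b) c"
  and chain_end_append: "chain_end w (c @ d) = chain_end (chain_end w c) d"
  by (simp_all add: chain_end_def)

lemma k_bruhat_chain_append:
  "k_bruhat_chain n k w (c @ d) \<longleftrightarrow> k_bruhat_chain n k w c \<and> k_bruhat_chain n k (chain_end w c) d"
proof (induction c arbitrary: w)
  case (Cons x c)
  obtain a b where x: "x = (a, b)" by fastforce
  show ?case
    using Cons.IH unfolding x by (simp add: chain_end_Cons del: comp_apply)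
qed simp

lemma k_bruhat_chain_row:
  assumes "w permutes {1..n}" "top_prefix n k w" and k: "1 \<le> k" and "k_bruhat_chain n k w c"
  shows "c = map (Pair k) (map snd c)" "chain_end w c permutes {1..n}" "top_prefix n k (chain_end w c)"
    and "w k + length c \<le> chain_end w c k" "set (map snd c) \<subseteq> {k<..n}" "row_path k w (map snd c)"
    and "chain_end w c = row_end k w (map snd c)"
proof -
  have claim: "(\<forall>y \<in> set c. fst y = k) \<and> chain_end w c permutes {1..n} \<and> top_prefix n k (chain_end w c) \<and>
    w k + length c \<le> chain_end w c k \<and> set (map snd c) \<subseteq> {k<..n} \<and> row_path k w (map snd c) \<and>
    chain_end w c = row_end k w (map snd c)"
    using assms(1,2,4)
  proof (induction c arbitrary: w)
    case (Cons x c)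
    obtain a b where x: "x = (a, b)" by fastforce
    have x': "a = k" "k < b" "b \<le> n" "covers w k b" and c: "k_bruhat_chain n k (w \<circ> transpose k b) c"
      using Cons.prems k_bruhat_cover_iff_covers[OF Cons.prems(1,2) k, of a b] unfolding x by auto
    define v where "v = w \<circ> transpose k b"
    have "w k < v k"
      using x' by (simp add: covers_def v_def)
    moreover have "chain_end w (x # c) = chain_end v c" "row_end k w (map snd (x # c)) = row_end k v (map snd c)"
      unfolding x x'(1) v_def by (simp_all only: chain_end_Cons row_end_Cons list.map snd_conv)
    moreover have "row_path k w (map snd (x # c)) \<longleftrightarrow> row_path k v (map snd c)"
      unfolding x v_def using x'(4) by (simp only: row_path.simps list.map snd_conv simp_thms)
    moreover note Cons.IH[OF row_step[OF Cons.prems(1,2) k x'(2,3)] c, folded v_def]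
    ultimately show ?case
      using x' unfolding x by auto
  qed simp
  have "Pair k (snd y) = y" if "y \<in> set c" for y
  proof -
    have "fst y = k" using that claim by blast
    then show ?thesis by (metis prod.collapse)
  qed
  then have "map (\<lambda>y. Pair k (snd y)) c = c"
    by (rule map_idI)
  then show "c = map (Pair k) (map snd c)"
    by (simp only: map_map comp_def)
  show "chain_end w c permutes {1..n}" "top_prefix n k (chain_end w c)"
    and "w k + length c \<le> chain_end w c k" "set (map snd c) \<subseteq> {k<..n}" "row_path k w (map snd c)"
    and "chain_end w c = row_end k w (map snd c)"
    using claim by blast+
qed

lemma k_bruhat_chain_row_path:
  assumes "w permutes {1..n}" "top_prefix n k w" and k: "1 \<le> k"
    and "set bs \<subseteq> {k<..n}" "row_path k w bs"
  shows "k_bruhat_chain n k w (map (Pair k) bs)"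
  using assms(1,2,4,5)
proof (induction bs arbitrary: w)
  case (Cons b bs)
  then have b: "k < b" "b \<le> n" by auto
  have "k_bruhat_cover n k w (k, b)"
    using k_bruhat_cover_iff_covers[OF Cons.prems(1,2) k] b Cons.prems(4) by simp
  moreover have "k_bruhat_chain n k (w \<circ> transpose k b) (map (Pair k) bs)"
  proof (rule Cons.IH[OF row_step[OF Cons.prems(1,2) k b]])
    show "set bs \<subseteq> {k<..n}" using Cons.prems(3) by simp
    show "row_path k (w \<circ> transpose k b) bs" using Cons.prems(4) unfolding row_path.simps by blast
  qed
  ultimately show ?case by simp
qed simp

lemma increasing_row_iff: "increasing (map (Pair k) bs) \<longleftrightarrow> sorted_wrt (>) bs"
proof -
  have "increasing (map (Pair k) bs) \<longleftrightarrow> successively (>) bs"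
    by (simp add: increasing_def successively_map)
  also have "\<dots> \<longleftrightarrow> sorted_wrt (>) bs"
    by (rule successively_conv_sorted_wrt) (auto intro: transpI)
  finally show ?thesis .
qed

abbreviation num_marks :: "marked_labels \<Rightarrow> nat" where
  "num_marks s \<equiv> length (filter snd s)"

definition row_chains :: "nat \<Rightarrow> nat \<Rightarrow> (nat \<Rightarrow> nat) \<Rightarrow> marked_labels set" where
  "row_chains n k w = {s. marked_chain n k w s \<and> chain_end w (map fst s) k = n + 1 - k}"

fun mark_first :: "nat \<Rightarrow> nat list \<Rightarrow> marked_labels" where
  "mark_first k [] = []"
| "mark_first k (b # bs) = ((k, b), True) # map (\<lambda>b. ((k, b), False)) bs"

lemma map_fst_mark_first: "map fst (mark_first k bs) = map (Pair k) bs"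
  by (cases bs) simp_all

lemma marks_mark_first:
  "bs \<noteq> [] \<Longrightarrow> num_marks (mark_first k bs) = 1" "length (mark_first k bs) = length bs"
  by (cases bs; simp)+

lemma row_chainsD:
  assumes w: "w permutes {1..n}" "top_prefix n k w" "1 \<le> k" "k \<le> n" and s: "s \<in> row_chains n k w"
  shows "w k + length s \<le> n + 1 - k" "1 \<le> w k"
    and "chain_end w (map fst s) permutes {1..n}" "top_prefix n (k + 1) (chain_end w (map fst s))"
    and "set s \<subseteq> ({k} \<times> {..n}) \<times> UNIV"
proof -
  have chain: "k_bruhat_chain n k w (map fst s)" and end_value: "chain_end w (map fst s) k = n + 1 - k"
    using s by (simp_all add: row_chains_def marked_chain_def)
  note row = k_bruhat_chain_row[OF w(1-3) chain]
  show "w k + length s \<le> n + 1 - k"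
    using row(4) end_value by simp
  show "1 \<le> w k"
    using permutes_in_image[OF w(1), of k] w(3,4) by simp
  show "chain_end w (map fst s) permutes {1..n}" by (rule row(2))
  show "top_prefix n (k + 1) (chain_end w (map fst s))"
    unfolding top_prefix_Suc using row(3) end_value by simp
  show "set s \<subseteq> ({k} \<times> {..n}) \<times> UNIV"
  proof
    fix x assume x: "x \<in> set s"
    then have "fst x \<in> set (map fst s)" by simp
    also have "map fst s = map (Pair k) (map snd (map fst s))"
      by (rule row(1))
    finally obtain b where "b \<in> set (map snd (map fst s))" "fst x = (k, b)"
      by auto
    then show "x \<in> ({k} \<times> {..n}) \<times> UNIV"
      using row(5) by (cases x) auto
  qed
qed

lemma finite_row_chains:
  assumes w: "w permutes {1..n}" "top_prefix n k w" "1 \<le> k" "k \<le> n"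
  shows "finite (row_chains n k w)"
proof (rule finite_subset)
  show "row_chains n k w \<subseteq> {s. set s \<subseteq> ({k} \<times> {..n}) \<times> UNIV \<and> length s \<le> n}"
  proof
    fix s assume s: "s \<in> row_chains n k w"
    show "s \<in> {s. set s \<subseteq> ({k} \<times> {..n}) \<times> UNIV \<and> length s \<le> n}"
      using row_chainsD(1,5)[OF w s] w(3) by simp
  qed
  show "finite {s :: marked_labels. set s \<subseteq> ({k} \<times> {..n}) \<times> UNIV \<and> length s \<le> n}"
    by (rule finite_lists_length_le) simp
qed

lemma unmarked_run_append:
  assumes "s = [] \<or> snd (hd s)"
  shows "takeWhile (\<lambda>y. \<not> snd y) (map (\<lambda>b. ((k, b), False)) bs @ s) = map (\<lambda>b. ((k, b), False)) bs"
    and "dropWhile (\<lambda>y. \<not> snd y) (map (\<lambda>b. ((k, b), False)) bs @ s) = s"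
  using assms by (cases s; simp add: takeWhile_append dropWhile_append)+

lemma marked_chain_mark_first_append:
  assumes w: "w permutes {1..n}" "top_prefix n k w" "1 \<le> k"
    and bs: "bs \<noteq> []" "bs \<in> falling_paths k [Suc k..<Suc n] w"
    and s: "marked_chain n k (row_end k w bs) s"
  shows "marked_chain n k w (mark_first k bs @ s)"
proof -
  obtain b cs where b: "bs = b # cs" using bs(1) by (cases bs) auto
  have bs': "set bs \<subseteq> {k<..n}" "row_path k w bs" "sorted_wrt (>) bs"
    using bs(2) by (auto simp: falling_paths_def)
  have chain: "k_bruhat_chain n k w (map (Pair k) bs)"
    by (rule k_bruhat_chain_row_path[OF w bs'(1,2)])
  moreover have "chain_end w (map (Pair k) bs) = row_end k w bs"
    using k_bruhat_chain_row(7)[OF w chain] by (simp add: comp_def)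
  moreover have "s = [] \<or> snd (hd s)"
    using s by (auto simp: marked_chain_def)
  moreover have "increasing (map fst (mark_first k bs))"
    unfolding map_fst_mark_first increasing_row_iff by (fact bs'(3))
  ultimately show ?thesis
    using s unfolding marked_chain_def map_append map_fst_mark_first k_bruhat_chain_append b
    by (simp add: unmarked_run_append comp_def)
qed

text \<open>
  A nonempty marked chain starts with a marked cover followed by all covers up to the next mark. The
  rest is empty or starts with a marked cover, so it is again a marked chain.
\<close>

lemma marked_chain_obtain_run:
  assumes w: "w permutes {1..n}" "top_prefix n k w" "1 \<le> k"
    and s: "marked_chain n k w s" "s \<noteq> []"
  obtains bs s' where "bs \<noteq> []" "bs \<in> falling_paths k [Suc k..<Suc n] w"
    "marked_chain n k (row_end k w bs) s'" "s = mark_first k bs @ s'"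
proof -
  let ?unmarked = "\<lambda>y :: label \<times> bool. \<not> snd y"
  obtain x c where xc: "s = x # c" using s(2) by (cases s) auto
  define c1 c2 where "c1 = takeWhile ?unmarked c" and "c2 = dropWhile ?unmarked c"
  have split: "s = (x # c1) @ c2"
    by (simp add: xc c1_def c2_def)
  have chain: "k_bruhat_chain n k w (map fst (x # c1))"
      "k_bruhat_chain n k (chain_end w (map fst (x # c1))) (map fst c2)"
    using s(1) unfolding marked_chain_def split map_append k_bruhat_chain_append by blast+
  have "snd x" and inc: "increasing (map fst (x # c1))" "\<forall>t \<in> set (cut_at_marks c2). increasing (map fst t)"
    using s(1) unfolding marked_chain_def xc c1_def c2_def by auto
  define bs where "bs = map snd (map fst (x # c1))"
  note row = k_bruhat_chain_row[OF w chain(1), folded bs_def]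
  show ?thesis
  proof
    show "bs \<noteq> []" by (simp add: bs_def)
    have "sorted_wrt (>) bs"
      using inc(1) unfolding row(1) increasing_row_iff .
    then show "bs \<in> falling_paths k [Suc k..<Suc n] w"
      using row(5,6) by (auto simp: falling_paths_def)
    have "c2 = [] \<or> snd (hd c2)"
      unfolding c2_def using hd_dropWhile[of ?unmarked c] by blast
    then show "marked_chain n k (row_end k w bs) c2"
      unfolding marked_chain_def row(7)[symmetric] using chain(2) inc(2) by blast
    have first: "fst (fst y) = k" if "y \<in> set (x # c1)" for y
    proof -
      have "fst y \<in> set (map fst (x # c1))"
        using that by auto
      then show ?thesis
        unfolding row(1) by auto
    qed
    have "x = ((k, snd (fst x)), True)"
      using first[of x] \<open>snd x\<close> by (simp add: prod_eq_iff)
    moreover have "c1 = map (\<lambda>b. ((k, b), False)) (map snd (map fst c1))"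
    proof -
      have "\<not> snd y" if "y \<in> set c1" for y
        using that set_takeWhileD[of y ?unmarked c] by (simp add: c1_def)
      then have "((k, snd (fst y)), False) = y" if "y \<in> set c1" for y
        using that first[of y] by (simp add: prod_eq_iff)
      then have "map (\<lambda>y. ((k, snd (fst y)), False)) c1 = c1"
        by (rule map_idI)
      then show ?thesis
        by (simp only: map_map comp_def)
    qed
    ultimately have "x # c1 = mark_first k bs"
      unfolding bs_def list.map mark_first.simps by metis
    then show "s = mark_first k bs @ c2"
      unfolding split by (simp only:)
  qed
qed

text \<open>
  One row of the sum over climbing chains; \<open>g\<close> stands for the contribution of the later rows.
\<close>

definition row_sum ::
    "nat \<Rightarrow> nat \<Rightarrow> ((nat \<Rightarrow> nat) \<Rightarrow> mpoly) \<Rightarrow> (nat \<Rightarrow> nat) \<Rightarrow> mpoly" where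
  "row_sum n k g w = (\<Sum>s \<in> row_chains n k w.
     (-1) ^ (length s - num_marks s) * X k ^ (n - k - num_marks s) * g (chain_end w (map fst s)))"

lemma falling_path_row:
  assumes w: "w permutes {1..n}" "top_prefix n k w" "1 \<le> k"
    and bs: "bs \<in> falling_paths k [Suc k..<Suc n] w"
  shows "row_end k w bs permutes {1..n}" "top_prefix n k (row_end k w bs)"
    "chain_end w (map (Pair k) bs) = row_end k w bs"
proof -
  have chain: "k_bruhat_chain n k w (map (Pair k) bs)"
    by (rule k_bruhat_chain_row_path[OF w]) (use bs in \<open>auto simp: falling_paths_def\<close>)
  have "map snd (map (Pair k) bs) = bs"
    by (simp add: comp_def)
  then show eq: "chain_end w (map (Pair k) bs) = row_end k w bs"
    using k_bruhat_chain_row(7)[OF w chain] by metis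
  show "row_end k w bs permutes {1..n}" "top_prefix n k (row_end k w bs)"
    using k_bruhat_chain_row(2,3)[OF w chain] unfolding eq by blast+
qed

lemma row_chains_top:
  assumes w: "w permutes {1..n}" "top_prefix n k w" "1 \<le> k" "k \<le> n" and top: "w k = n + 1 - k"
  shows "row_chains n k w = {[]}"
proof -
  have "s = []" if "s \<in> row_chains n k w" for s
    using row_chainsD(1)[OF w that] top by simp
  moreover have "[] \<in> row_chains n k w"
    using top by (simp add: row_chains_def marked_chain_def)
  ultimately show ?thesis by blast
qed

lemma mark_first_append_inject:
  assumes "bs \<noteq> []" "cs \<noteq> []" "s = [] \<or> snd (hd s)" "t = [] \<or> snd (hd t)"
    and eq: "mark_first k bs @ s = mark_first k cs @ t"
  shows "bs = cs \<and> s = t"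
proof -
  obtain b bs' c cs' where bs: "bs = b # bs'" "cs = c # cs'"
    using assms(1,2) by (cases bs; cases cs) auto
  let ?m = "map (\<lambda>b. ((k, b), False))"
  have "b = c" and tail: "?m bs' @ s = ?m cs' @ t"
    using eq by (simp_all add: bs)
  have "?m bs' = ?m cs'"
    using unmarked_run_append(1)[OF assms(3), of k bs'] unmarked_run_append(1)[OF assms(4), of k cs']
    unfolding tail by metis
  moreover have "inj (\<lambda>b. ((k, b), False))"
    by (simp add: inj_def)
  ultimately have "bs' = cs'"
    by (metis inj_map_eq_map)
  then show ?thesis
    using tail \<open>b = c\<close> bs by simp
qed

lemma bij_betw_first_run:
  assumes w: "w permutes {1..n}" "top_prefix n k w" "1 \<le> k" "k \<le> n" and low: "w k < n + 1 - k"
  shows "bij_betw (\<lambda>(bs, s). mark_first k bs @ s)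
    (SIGMA bs : falling_paths k [Suc k..<Suc n] w - {[]}. row_chains n k (row_end k w bs))
    (row_chains n k w)" (is "bij_betw ?f ?A ?B")
proof (rule bij_betw_imageI)
  have marked: "s = [] \<or> snd (hd s)" if "s \<in> row_chains n k v" for s v
    using that by (auto simp: row_chains_def marked_chain_def)
  show "inj_on ?f ?A"
  proof (rule inj_onI)
    fix p q assume p: "p \<in> ?A" and q: "q \<in> ?A" and eq: "?f p = ?f q"
    obtain bs s cs t where pq: "p = (bs, s)" "q = (cs, t)" by fastforce
    have "bs = cs \<and> s = t"
      by (rule mark_first_append_inject) (use p q eq marked pq in auto)
    then show "p = q" using pq by simp
  qed
  show "?f ` ?A = ?B"
  proof (intro equalityI subsetI)
    fix t assume "t \<in> ?f ` ?A"
    then obtain bs s where t: "t = mark_first k bs @ s" "bs \<noteq> []" "bs \<in> falling_paths k [Suc k..<Suc n] w"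
        "s \<in> row_chains n k (row_end k w bs)"
      by auto
    have "chain_end w (map fst t) = chain_end (row_end k w bs) (map fst s)"
      unfolding t(1) map_append map_fst_mark_first chain_end_append falling_path_row(3)[OF w(1-3) t(3)] ..
    moreover have "marked_chain n k w t"
      unfolding t(1) by (rule marked_chain_mark_first_append[OF w(1-3) t(2,3)])
        (use t(4) in \<open>simp add: row_chains_def\<close>)
    ultimately show "t \<in> ?B"
      using t(4) unfolding row_chains_def mem_Collect_eq by metis
  next
    fix t assume t: "t \<in> ?B"
    then have chain: "marked_chain n k w t" and end_value: "chain_end w (map fst t) k = n + 1 - k"
      by (simp_all add: row_chains_def)
    have "t \<noteq> []"
      using end_value low by auto
    then obtain bs s where s: "bs \<noteq> []" "bs \<in> falling_paths k [Suc k..<Suc n] w"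
        "marked_chain n k (row_end k w bs) s" "t = mark_first k bs @ s"
      by (rule marked_chain_obtain_run[OF w(1-3) chain])
    have "chain_end w (map fst t) = chain_end (row_end k w bs) (map fst s)"
      unfolding s(4) map_append map_fst_mark_first chain_end_append falling_path_row(3)[OF w(1-3) s(2)] ..
    then have "s \<in> row_chains n k (row_end k w bs)"
      using s(3) end_value unfolding row_chains_def mem_Collect_eq by metis
    then show "t \<in> ?f ` ?A"
      using s by (intro image_eqI[of _ _ "(bs, s)"]) auto
  qed
qed

lemma row_sum_top:
  assumes "w permutes {1..n}" "top_prefix n k w" "1 \<le> k" "k \<le> n" "w k = n + 1 - k"
  shows "row_sum n k g w = X k ^ (n - k) * g w"
  unfolding row_sum_def row_chains_top[OF assms] by simp

text \<open>
  Splitting off the first run \<open>bs\<close> of a chain removes one mark, which accounts for a factor \<open>X k\<close>, and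
  \<open>length bs - 1\<close> unmarked covers, which account for the sign. So \<open>X k\<close> times the sum is minus the
  signed sum over nonempty runs, while \<open>R\<^sub>k\<close> is the signed sum over all runs.
\<close>

lemma row_sum_monk:
  assumes w: "w permutes {1..n}" "top_prefix n k w" "1 \<le> k" "k \<le> n" and low: "w k < n + 1 - k"
  shows "(1 - X k) * row_sum n k g w = monk_row n k (row_sum n k g) w"
proof -
  let ?D = "falling_paths k [Suc k..<Suc n] w"
  let ?t = "\<lambda>v s. (-1) ^ (length s - num_marks s) * X k ^ (n - k - num_marks s) * g (chain_end v (map fst s))"
  have D: "falling_paths k (rev [Suc k..<Suc n]) w = ?D"
    by (simp only: falling_paths_def set_rev)
  have summand: "X k * ?t w (mark_first k bs @ s) = - ((-1) ^ length bs * ?t (row_end k w bs) s)"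
    if bs: "bs \<in> ?D - {[]}" and s: "s \<in> row_chains n k (row_end k w bs)" for bs s
  proof -
    have len: "length bs \<noteq> 0" and marks: "num_marks s \<le> length s"
      using bs by auto
    have in_row: "mark_first k bs @ s \<in> row_chains n k w"
      using bij_betw_first_run[OF w low] bs s by (auto simp: bij_betw_def)
    have "length bs + length s \<le> n - k"
      using row_chainsD(1,2)[OF w in_row] marks_mark_first(2)[of k bs] by simp
    moreover have split: "num_marks (mark_first k bs @ s) = 1 + num_marks s"
        "length (mark_first k bs @ s) = length bs + length s"
      using marks_mark_first(1)[of bs k] marks_mark_first(2)[of k bs] len by simp_all
    ultimately have "n - k - num_marks s = Suc (n - k - num_marks (mark_first k bs @ s))"
      using len marks by linarith
    moreover have "length (mark_first k bs @ s) - num_marks (mark_first k bs @ s) =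
        (length bs - 1) + (length s - num_marks s)"
      unfolding split using len marks by linarith
    moreover have "chain_end w (map fst (mark_first k bs @ s)) = chain_end (row_end k w bs) (map fst s)"
      unfolding map_append map_fst_mark_first chain_end_append
      using falling_path_row(3)[OF w(1-3)] bs by (metis DiffD1)
    moreover have "(-1 :: mpoly) ^ length bs = - ((-1) ^ (length bs - 1))"
      using len by (cases bs) simp_all
    ultimately show ?thesis
      by (simp only: power_add power_Suc mult.assoc mult.left_commute[of "X k"]) simp
  qed
  have fin: "finite (row_chains n k (row_end k w bs))" if "bs \<in> ?D" for bs
    by (rule finite_row_chains[OF falling_path_row(1,2)[OF w(1-3) that] w(3,4)])
  have "X k * row_sum n k g w = (\<Sum>s \<in> row_chains n k w. X k * ?t w s)"
    by (simp only: row_sum_def sum_distrib_left)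
  also have "\<dots> = (\<Sum>(bs, s) \<in> (SIGMA bs : ?D - {[]}. row_chains n k (row_end k w bs)).
      X k * ?t w (mark_first k bs @ s))"
    by (subst sum.reindex_bij_betw[OF bij_betw_first_run[OF w low], symmetric]) (simp only: case_prod_unfold)
  also have "\<dots> = (\<Sum>bs \<in> ?D - {[]}. \<Sum>s \<in> row_chains n k (row_end k w bs). X k * ?t w (mark_first k bs @ s))"
    by (rule sum.Sigma[symmetric]) (use fin finite_falling_paths in auto)
  also have "\<dots> = (\<Sum>bs \<in> ?D - {[]}. - ((-1) ^ length bs * row_sum n k g (row_end k w bs)))"
    unfolding row_sum_def sum_distrib_left sum_negf[symmetric] by (intro sum.cong refl summand)
  also have "\<dots> = row_sum n k g w - (\<Sum>bs \<in> ?D. (-1) ^ length bs * row_sum n k g (row_end k w bs))"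
  proof -
    have "[] \<in> ?D" by (simp add: falling_paths_def)
    then show ?thesis
      unfolding sum_negf sum.remove[OF finite_falling_paths \<open>[] \<in> ?D\<close>] by simp
  qed
  also have "(\<Sum>bs \<in> ?D. (-1) ^ length bs * row_sum n k g (row_end k w bs)) = monk_row n k (row_sum n k g) w"
  proof -
    have "sorted_wrt (>) (rev [Suc k..<Suc n])"
      unfolding sorted_wrt_rev by (rule sorted_wrt_upt)
    then show ?thesis
      unfolding monk_row_def by (simp only: row_diff_eq_sum_falling_paths D)
  qed
  finally show ?thesis
    by (simp add: algebra_simps)
qed

section \<open>Climbing marked chains\<close>

fun climb_sum :: "nat \<Rightarrow> nat \<Rightarrow> nat \<Rightarrow> (nat \<Rightarrow> nat) \<Rightarrow> mpoly" where
  "climb_sum n 0 k = (\<lambda>_. 1)"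
| "climb_sum n (Suc r) k = row_sum n k (climb_sum n r (k + 1))"

lemma swap_vars_climb_sum: "i + 1 < k \<Longrightarrow> swap_vars i (climb_sum n r k w) = climb_sum n r k w"
proof (induction r arbitrary: k w)
  case (Suc r)
  have "swap_vars i (-1) = -1"
    by (simp add: swap_vars_uminus)
  then have "swap_vars i ((-1) ^ a * X k ^ b * climb_sum n r (k + 1) v) = (-1) ^ a * X k ^ b * climb_sum n r (k + 1) v" for a b v
    using Suc by (simp add: swap_vars_mult swap_vars_power swap_vars_X)
  then show ?case
    unfolding climb_sum.simps row_sum_def swap_vars_sum by (simp only:)
qed simp

text \<open>
  Rows that have already been climbed only contribute the empty segment, with weight \<open>X j ^ (n - j)\<close>.
\<close>

lemma climb_sum_top_prefix:
  assumes w: "w permutes {1..n}" and "1 \<le> k" "k \<le> n + 1" "top_prefix n k w"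
  shows "climb_sum n (n - 1) 1 w = (\<Prod>j = 1..<k. X j ^ (n - j)) * climb_sum n (n - k) k w"
  using assms(2-4)
proof (induction k rule: dec_induct)
  case (step k)
  have "top_prefix n k w" and wk: "w k = n + 1 - k"
    using step top_prefix_Suc[of n k w] by simp_all
  moreover have "climb_sum n (n - k) k w = X k ^ (n - k) * climb_sum n (n - Suc k) (Suc k) w"
  proof (cases "k = n")
    case False
    then have r: "n - k = Suc (n - Suc k)"
      using step by simp
    show ?thesis
      unfolding r climb_sum.simps Suc_eq_plus1[symmetric]
      by (subst row_sum_top) (use w step wk \<open>top_prefix n k w\<close> r in auto)
  qed simp
  ultimately show ?case
    using step by (simp add: mult.assoc)
qed simp

text \<open>
  The Monk formula of row \<open>k\<close> survives multiplication by the weight of the rows before, a factor that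
  all permutations occurring in it share.
\<close>

lemma monk_family_climb_sum: "monk_family n (climb_sum n (n - 1) 1)"
proof
  fix w k
  assume w: "w permutes {1..n}" "1 \<le> k" "k \<le> n" "top_prefix n k w" and low: "w k < n + 1 - k"
  let ?F = "climb_sum n (n - 1) 1" and ?S = "climb_sum n (n - k) k"
  let ?p = "\<Prod>j = 1..<k. X j ^ (n - j)"
  have F: "?F v = ?p * ?S v" if "v permutes {1..n}" "top_prefix n k v" for v
    by (rule climb_sum_top_prefix) (use that w in auto)
  have "w k \<noteq> 0"
    using permutes_in_image[OF w(1), of k] w by auto
  then obtain r where r: "n - k = Suc r"
    using low by (cases "n - k") auto
  have "(1 - X k) * ?F w = ?p * ((1 - X k) * ?S w)"
    unfolding F[OF w(1,4)] by (rule mult.left_commute)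
  also have "\<dots> = ?p * monk_row n k ?S w"
    unfolding r climb_sum.simps by (subst row_sum_monk[OF w(1,4,2,3) low]) (rule refl)
  also have "\<dots> = monk_row n k (\<lambda>v. ?p * ?S v) w"
    by (rule monk_row_additive[symmetric]) (rule right_diff_distrib)
  also have "\<dots> = monk_row n k ?F w"
  proof -
    have "monk_row n k ?F w - monk_row n k (\<lambda>v. ?p * ?S v) w = ?F w - ?p * ?S w"
      by (rule monk_row_cong_above[where j = k and P = "\<lambda>_. True"]) (use w F in auto)
    then show ?thesis
      unfolding F[OF w(1,4)] by simp
  qed
  finally show "(1 - X k) * ?F w = monk_row n k ?F w" .
next
  fix w i
  assume w: "w permutes {1..n}" "1 \<le> i" "i < n" "top_prefix n (i + 2) w"
  let ?H = "(\<Prod>j = 1..<i. X j ^ (n - j)) * (X i * X (i + 1)) ^ (n - Suc i) * climb_sum n (n - (i + 2)) (i + 2) w"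
  have "{1..<i + 2} = insert i (insert (i + 1) {1..<i})"
    using w by auto
  then have "(\<Prod>j = 1..<i + 2. X j ^ (n - j)) =
      X i ^ (n - i) * (X (i + 1) ^ (n - Suc i) * (\<Prod>j = 1..<i. X j ^ (n - j)))"
    by simp
  also have "n - i = Suc (n - Suc i)"
    using w by simp
  finally have prefix: "(\<Prod>j = 1..<i + 2. X j ^ (n - j)) =
      X i * ((\<Prod>j = 1..<i. X j ^ (n - j)) * (X i * X (i + 1)) ^ (n - Suc i))"
    by (simp add: power_mult_distrib algebra_simps)
  have "climb_sum n (n - 1) 1 w = (\<Prod>j = 1..<i + 2. X j ^ (n - j)) * climb_sum n (n - (i + 2)) (i + 2) w"
    by (rule climb_sum_top_prefix) (use w in auto)
  then have "climb_sum n (n - 1) 1 w = X i * ?H"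
    unfolding prefix by (simp only: mult.assoc)
  moreover have "swap_vars i ?H = ?H"
    by (simp add: swap_vars_mult swap_vars_prod swap_vars_power swap_vars_X swap_vars_climb_sum mult.commute)
  ultimately show "\<exists>H. swap_vars i H = H \<and> climb_sum n (n - 1) 1 w = X i * H"
    by blast
qed

lemma climb_sum_omega0: "climb_sum n (n - 1) 1 (omega0 n) = xpow n (\<lambda>k. n - k)"
proof -
  have "climb_sum n (n - 1) 1 (omega0 n) =
      (\<Prod>j = 1..<n + 1. X j ^ (n - j)) * climb_sum n (n - (n + 1)) (n + 1) (omega0 n)"
    by (rule climb_sum_top_prefix[OF omega0_permutes]) (auto simp: top_prefix_def omega0_def)
  also have "\<dots> = (\<Prod>j = 1..<n + 1. X j ^ (n - j))"
    by simp
  also have "\<dots> = xpow n (\<lambda>k. n - k)"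
    unfolding xpow_def by (rule prod.mono_neutral_right) auto
  finally show ?thesis .
qed

lemma grothendieck_eq_climb_sum:
  assumes "w permutes {1..n}"
  shows "grothendieck n w = climb_sum n (n - 1) 1 w"
  by (rule monk_family.grothendieck_eq[OF monk_family_climb_sum assms climb_sum_omega0])

text \<open>
  Climbing chains by recursion on the remaining rows, for rows \<open>k\<close> to \<open>k + r - 1\<close>.
\<close>

fun climbs :: "nat \<Rightarrow> nat \<Rightarrow> nat \<Rightarrow> (nat \<Rightarrow> nat) \<Rightarrow> marked_labels list set" where
  "climbs n 0 k w = {[]}"
| "climbs n (Suc r) k w =
     (\<lambda>(s, \<gamma>). s # \<gamma>) ` (SIGMA s : row_chains n k w. climbs n r (k + 1) (chain_end w (map fst s)))"

lemma finite_climbs: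
  assumes "w permutes {1..n}" "top_prefix n k w" "1 \<le> k" "k + r \<le> n + 1"
  shows "finite (climbs n r k w)"
  using assms
proof (induction r arbitrary: k w)
  case (Suc r)
  have "finite (row_chains n k w)"
    by (rule finite_row_chains) (use Suc.prems in auto)
  moreover have "finite (climbs n r (k + 1) (chain_end w (map fst s)))" if "s \<in> row_chains n k w" for s
    by (rule Suc.IH) (use row_chainsD(3,4)[OF Suc.prems(1-3) _ that] Suc.prems in auto)
  ultimately show ?case
    by (simp add: finite_SigmaI)
qed simp

lemma climb_sum_eq_sum_climbs:
  assumes "w permutes {1..n}" "top_prefix n k w" "1 \<le> k" "k + r \<le> n + 1"
  shows "climb_sum n r k w = (\<Sum>\<gamma> \<in> climbs n r k w.
    (-1) ^ (num_covers \<gamma> - num_marked \<gamma>) * (\<Prod>j<r. X (k + j) ^ (n - (k + j) - num_marks (\<gamma> ! j))))"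
  using assms
proof (induction r arbitrary: k w)
  case 0
  then show ?case by (simp add: num_covers_def num_marked_def)
next
  case (Suc r)
  let ?e = "\<lambda>s. chain_end w (map fst s)"
  let ?t = "\<lambda>r k \<gamma>. (-1) ^ (num_covers \<gamma> - num_marked \<gamma>) *
      (\<Prod>j<r. X (k + j) ^ (n - (k + j) - num_marks (\<gamma> ! j))) :: mpoly"
  have row: "?e s permutes {1..n}" "top_prefix n (k + 1) (?e s)" if "s \<in> row_chains n k w" for s
    using row_chainsD(3,4)[OF Suc.prems(1-3) _ that] Suc.prems by auto
  have IH: "climb_sum n r (k + 1) (?e s) = (\<Sum>\<gamma> \<in> climbs n r (k + 1) (?e s). ?t r (k + 1) \<gamma>)"
    if "s \<in> row_chains n k w" for s
    by (rule Suc.IH) (use row[OF that] Suc.prems in auto)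
  have cons: "(-1) ^ (length s - num_marks s) * X k ^ (n - k - num_marks s) * ?t r (k + 1) \<gamma> =
      ?t (Suc r) k (s # \<gamma>)" for s \<gamma>
  proof -
    have "num_covers (s # \<gamma>) - num_marked (s # \<gamma>) =
        (length s - num_marks s) + (num_covers \<gamma> - num_marked \<gamma>)"
      using length_filter_le[of snd s] length_filter_le[of snd "concat \<gamma>"]
      by (simp add: num_covers_def num_marked_def)
    note signs = this
    show ?thesis
      unfolding signs power_add prod.lessThan_Suc_shift by (simp add: mult.assoc mult.left_commute)
  qed
  have "climb_sum n (Suc r) k w =
      (\<Sum>s \<in> row_chains n k w. \<Sum>\<gamma> \<in> climbs n r (k + 1) (?e s). ?t (Suc r) k (s # \<gamma>))"
    unfolding climb_sum.simps row_sum_def by (intro sum.cong refl) (simp only: IH sum_distrib_left cons)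
  also have "\<dots> = (\<Sum>(s, \<gamma>) \<in> (SIGMA s : row_chains n k w. climbs n r (k + 1) (?e s)). ?t (Suc r) k (s # \<gamma>))"
  proof (rule sum.Sigma)
    show "finite (row_chains n k w)"
      by (rule finite_row_chains) (use Suc.prems in auto)
    show "\<forall>s \<in> row_chains n k w. finite (climbs n r (k + 1) (?e s))"
      using row finite_climbs[of _ n "k + 1" r] Suc.prems by auto
  qed
  also have "\<dots> = (\<Sum>\<gamma> \<in> climbs n (Suc r) k w. ?t (Suc r) k \<gamma>)"
    unfolding climbs.simps by (subst sum.reindex) (auto simp: inj_on_def split_beta intro!: sum.cong)
  finally show ?case .
qed

lemma perm_after_Cons_Suc: "perm_after w (s # \<gamma>) (Suc j) = perm_after (chain_end w (map fst s)) \<gamma> j"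
  by (simp add: perm_after_def chain_end_append)

lemma mem_climbs_iff:
  assumes "w permutes {1..n}" "top_prefix n k w" "1 \<le> k" "k + r \<le> n + 1"
  shows "\<gamma> \<in> climbs n r k w \<longleftrightarrow> length \<gamma> = r \<and>
    (\<forall>j<r. marked_chain n (k + j) (perm_after w \<gamma> j) (\<gamma> ! j) \<and>
           top_prefix n (k + j + 1) (perm_after w \<gamma> (Suc j)))"
  using assms
proof (induction r arbitrary: k w \<gamma>)
  case (Suc r)
  show ?case
  proof (cases \<gamma>)
    case Nil
    then show ?thesis by auto
  next
    case (Cons s \<delta>)
    let ?v = "chain_end w (map fst s)"
    have k: "k \<le> n" using Suc.prems by simp
    have first: "s \<in> row_chains n k w \<longleftrightarrow> marked_chain n k w s \<and> top_prefix n (k + 1) ?v"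
    proof -
      have "s \<in> row_chains n k w" if "marked_chain n k w s" "top_prefix n (k + 1) ?v"
        using that Suc.prems(3) unfolding row_chains_def top_prefix_Suc by simp
      moreover have "marked_chain n k w s \<and> top_prefix n (k + 1) ?v" if "s \<in> row_chains n k w"
        using row_chainsD(4)[OF Suc.prems(1-3) k that] that by (simp add: row_chains_def)
      ultimately show ?thesis by blast
    qed
    have "\<gamma> \<in> climbs n (Suc r) k w \<longleftrightarrow> s \<in> row_chains n k w \<and> \<delta> \<in> climbs n r (k + 1) ?v"
      unfolding Cons by auto
    also have "\<dots> \<longleftrightarrow> s \<in> row_chains n k w \<and> length \<delta> = r \<and>
        (\<forall>j<r. marked_chain n (k + 1 + j) (perm_after ?v \<delta> j) (\<delta> ! j) \<and>
               top_prefix n (k + 1 + j + 1) (perm_after ?v \<delta> (Suc j)))"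
    proof (rule conj_cong[OF refl])
      assume "s \<in> row_chains n k w"
      from row_chainsD(3,4)[OF Suc.prems(1-3) k this]
      show "\<delta> \<in> climbs n r (k + 1) ?v \<longleftrightarrow> length \<delta> = r \<and>
        (\<forall>j<r. marked_chain n (k + 1 + j) (perm_after ?v \<delta> j) (\<delta> ! j) \<and>
               top_prefix n (k + 1 + j + 1) (perm_after ?v \<delta> (Suc j)))"
        using Suc.prems by (intro Suc.IH) auto
    qed
    finally show ?thesis
      unfolding first Cons All_less_Suc2
      by (simp add: perm_after_Cons_Suc perm_after_def chain_end_append) blast
  qed
qed auto

lemma climbs_end:
  assumes "w permutes {1..n}" "top_prefix n k w" "1 \<le> k" "k + r \<le> n + 1" "\<gamma> \<in> climbs n r k w"
  shows "length \<gamma> = r \<and> chain_end w (map fst (concat \<gamma>)) permutes {1..n} \<and>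
    top_prefix n (k + r) (chain_end w (map fst (concat \<gamma>)))"
  using assms
proof (induction r arbitrary: k w \<gamma>)
  case (Suc r)
  then obtain s \<delta> where \<gamma>: "\<gamma> = s # \<delta>" "s \<in> row_chains n k w" "\<delta> \<in> climbs n r (k + 1) (chain_end w (map fst s))"
    by auto
  have "k \<le> n" using Suc.prems by simp
  note row = row_chainsD(3,4)[OF Suc.prems(1-3) \<open>k \<le> n\<close> \<gamma>(2)]
  show ?case
    using Suc.IH[OF row _ _ \<gamma>(3)] Suc.prems(4) unfolding \<gamma>(1) by (simp add: chain_end_append)
qed simp

lemma eq_omega0_if_top_prefix:
  assumes u: "u permutes {1..n}" "top_prefix n n u"
  shows "u = omega0 n"
proof
  fix j
  consider "j = 0 \<or> n < j" | "1 \<le> j" "j < n" | "j = n" "1 \<le> n" by linarith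
  then show "u j = omega0 n j"
  proof cases
    case 1
    then show ?thesis
      using permutes_not_in[OF u(1), of j] by (auto simp: omega0_def)
  next
    case 2
    then show ?thesis
      using u(2) by (simp add: top_prefix_def omega0_def)
  next
    case 3
    then have "u n \<le> 1" "1 \<le> u n"
      using top_prefix_le[OF u, of n] permutes_in_image[OF u(1), of n] by simp_all
    then show ?thesis
      using 3 by (simp add: omega0_def)
  qed
qed

lemma climbing_marked_chain_iff:
  assumes w: "w permutes {1..n}"
  shows "climbing_marked_chain n w \<gamma> \<longleftrightarrow> \<gamma> \<in> climbs n (n - 1) 1 w"
proof -
  let ?P = "\<lambda>k. marked_chain n k (perm_after w \<gamma> (k - 1)) (\<gamma> ! (k - 1)) \<and> top_prefix n (k + 1) (perm_after w \<gamma> k)"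
  have shift: "(\<forall>k \<in> {1..<n}. ?P k) \<longleftrightarrow> (\<forall>j<n - 1. ?P (1 + j))"
  proof -
    have "k \<in> {1..<n} \<longleftrightarrow> (\<exists>j<n - 1. k = 1 + j)" for k
    proof
      assume "k \<in> {1..<n}"
      then have "k - 1 < n - 1 \<and> k = 1 + (k - 1)" by auto
      then show "\<exists>j<n - 1. k = 1 + j" by blast
    qed auto
    then show ?thesis by (simp only: Ball_def) metis
  qed
  have start: "top_prefix n 1 w" "1 + (n - 1) \<le> n + 1"
    by (auto simp: top_prefix_def)
  have climbs: "\<gamma> \<in> climbs n (n - 1) 1 w \<longleftrightarrow> length \<gamma> = n - 1 \<and> (\<forall>k \<in> {1..<n}. ?P k)"
    unfolding shift mem_climbs_iff[OF w start(1) order.refl start(2)] by simp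
  have "perm_after w \<gamma> (n - 1) = omega0 n" if "\<gamma> \<in> climbs n (n - 1) 1 w"
  proof -
    have "length \<gamma> = n - 1 \<and> chain_end w (map fst (concat \<gamma>)) permutes {1..n} \<and>
        top_prefix n (1 + (n - 1)) (chain_end w (map fst (concat \<gamma>)))"
      by (rule climbs_end[OF w start(1) order.refl start(2) that])
    moreover from this have "perm_after w \<gamma> (n - 1) = chain_end w (map fst (concat \<gamma>))"
      by (simp add: perm_after_def)
    ultimately show ?thesis
      using top_prefix_mono[of n "1 + (n - 1)" _ n] by (intro eq_omega0_if_top_prefix) simp_all
  qed
  moreover have "(\<forall>i \<in> {1..k}. u i = n + 1 - i) \<longleftrightarrow> top_prefix n (k + 1) u" for k u
    unfolding top_prefix_def by auto
  moreover from this have "climbing_marked_chain n w \<gamma> \<longleftrightarrow>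
      length \<gamma> = n - 1 \<and> (\<forall>k \<in> {1..<n}. ?P k) \<and> perm_after w \<gamma> (n - 1) = omega0 n"
    unfolding climbing_marked_chain_def segment_def by (simp only:)
  ultimately show ?thesis
    unfolding climbs by blast
qed

lemma exact_div_xpow:
  assumes "\<And>k. 1 \<le> k \<Longrightarrow> k < n \<Longrightarrow> \<alpha> k \<le> \<delta> k"
  shows "exact_div (xpow n \<delta>) (xpow n \<alpha>) = xpow n (\<lambda>k. \<delta> k - \<alpha> k)"
proof (rule exact_div_eqI)
  show "xpow n (\<lambda>k. \<delta> k - \<alpha> k) * xpow n \<alpha> = xpow n \<delta>"
    unfolding xpow_def prod.distrib[symmetric]
    by (rule prod.cong) (use assms in \<open>auto simp flip: power_add\<close>)
  show "xpow n \<alpha> \<noteq> 0"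
    by (simp add: xpow_def X_neq_0)
qed

lemma num_marks_climbs_le:
  assumes "w permutes {1..n}" "top_prefix n k w" "1 \<le> k" "k + r \<le> n + 1" "\<gamma> \<in> climbs n r k w" "j < r"
  shows "num_marks (\<gamma> ! j) \<le> n - (k + j)"
  using assms
proof (induction r arbitrary: k w \<gamma> j)
  case (Suc r)
  then obtain s \<delta> where \<gamma>: "\<gamma> = s # \<delta>" "s \<in> row_chains n k w" "\<delta> \<in> climbs n r (k + 1) (chain_end w (map fst s))"
    by auto
  have "k \<le> n" using Suc.prems by simp
  note row = row_chainsD[OF Suc.prems(1-3) \<open>k \<le> n\<close> \<gamma>(2)]
  show ?case
  proof (cases j)
    case 0
    then show ?thesis
      using row(1,2) length_filter_le[of snd s] unfolding \<gamma>(1) 0 nth_Cons_0 add_0_right by linarith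
  next
    case (Suc i)
    then show ?thesis
      using Suc.IH[OF row(3,4) _ _ \<gamma>(3), of i] Suc.prems unfolding \<gamma>(1) by simp
  qed
qed simp

theorem theorem5p6:
  fixes n :: nat and w :: "nat \<Rightarrow> nat"
  assumes "w permutes {1..n}"
  shows "grothendieck n w =
    (\<Sum>\<gamma> | climbing_marked_chain n w \<gamma>.
       (-1) ^ (num_covers \<gamma> - num_marked \<gamma>) *
       exact_div (xpow n (\<lambda>k. n - k)) (xpow n (weight \<gamma>)))"
proof -
  have start: "top_prefix n 1 w" "1 + (n - 1) \<le> n + 1"
    by (auto simp: top_prefix_def)
  have "grothendieck n w = (\<Sum>\<gamma> \<in> climbs n (n - 1) 1 w. (-1) ^ (num_covers \<gamma> - num_marked \<gamma>) *
      (\<Prod>j<n - 1. X (1 + j) ^ (n - (1 + j) - num_marks (\<gamma> ! j))))"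
    unfolding grothendieck_eq_climb_sum[OF assms]
    by (rule climb_sum_eq_sum_climbs[OF assms start(1) order.refl start(2)])
  also have "\<dots> = (\<Sum>\<gamma> \<in> climbs n (n - 1) 1 w. (-1) ^ (num_covers \<gamma> - num_marked \<gamma>) *
       exact_div (xpow n (\<lambda>k. n - k)) (xpow n (weight \<gamma>)))"
  proof (intro sum.cong refl arg_cong2[where f = "(*)"])
    fix \<gamma> assume \<gamma>: "\<gamma> \<in> climbs n (n - 1) 1 w"
    have "weight \<gamma> k \<le> n - k" if "1 \<le> k" "k < n" for k
      using num_marks_climbs_le[OF assms start(1) order.refl start(2) \<gamma>, of "k - 1"] that
      by (simp add: weight_def segment_def)
    then have "exact_div (xpow n (\<lambda>k. n - k)) (xpow n (weight \<gamma>)) = xpow n (\<lambda>k. n - k - weight \<gamma> k)"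
      by (rule exact_div_xpow)
    also have "\<dots> = (\<Prod>j<n - 1. X (1 + j) ^ (n - (1 + j) - num_marks (\<gamma> ! j)))"
      unfolding xpow_def
      by (rule prod.reindex_bij_witness[of _ Suc "\<lambda>k. k - 1"]) (auto simp: weight_def segment_def)
    finally show "(\<Prod>j<n - 1. X (1 + j) ^ (n - (1 + j) - num_marks (\<gamma> ! j))) =
        exact_div (xpow n (\<lambda>k. n - k)) (xpow n (weight \<gamma>))" ..
  qed
  also have "climbs n (n - 1) 1 w = {\<gamma>. climbing_marked_chain n w \<gamma>}"
    using climbing_marked_chain_iff[OF assms] by blast
  finally show ?thesis .
qed

end
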